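(* For every interval $I\subset\mathbb{R}$ and every real $\lambda\ge\frac13$, $$ \dim S_g(I,\lambda) \le \max\left\{\frac{2-2\lambda}{1+\lambda},0\right\}. $$
   Context: $\dim$ denotes Hausdorff dimension (the empty set has dimension $0$). For coprime $(u,v)\in\mathbb{Z}^2$, let $L_{P_{u,v}}\subset\mathbb{R}^4$ be the two-dimensional linear subspace attached to the polynomial $P_{u,v}(x)=(vx-u)^2$, namely the set of $(x_0,x_1,x_2,x_3)$ with $$u^2x_0-2uvx_1+v^2x_2=0,\qquad u^2x_1-2uvx_2+v^2x_3=0.$$ A point $\mathbf p=(p_0,p_1,p_2,p_3)\in\mathbb{Z}^4$ is called special if $\mathbf p\in L_{P_{u,v}}$ for some coprime $(u,v)\in\mathbb{Z}^2$; all other points of $\mathbb{Z}^4$ are called generic. $S_g(I,\lambda)$ is the set of all $x\in I$ such that $$\max_{1\le i\le3}|p_0x^i-p_i|<p_0^{-\lambda}$$ for infinitely many generic $\mathbf p=(p_0,p_1,p_2,p_3)\in\mathbb{Z}_{>0}\times\mathbb{Z}^3$. *)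

theory Defs
  imports "HOL-Analysis.Analysis"
begin

text \<open>
  The \<open>s\<close>-th power of the diameter of a covering set. The library has \<open>0 powr 0 = 0\<close>, so the
  exponent \<open>0\<close> is treated separately: every nonempty set has weight \<open>1\<close> and the empty set
  weight \<open>0\<close>, which makes the \<open>0\<close>-dimensional measure the counting measure.
  The library's \<open>diameter\<close> is only meaningful on bounded sets; covers below are by bounded sets.
\<close>

definition diam_pow :: "real \<Rightarrow> 'a::metric_space set \<Rightarrow> ennreal" where
  "diam_pow s U =
     (if U = {} then 0 else if s = 0 then 1 else ennreal (diameter U powr s))"

definition hausdorff_premeasure :: "real \<Rightarrow> real \<Rightarrow> 'a::metric_space set \<Rightarrow> ennreal" where
  "hausdorff_premeasure s \<delta> A =
     (INF U \<in> {U :: nat \<Rightarrow> 'a set. A \<subseteq> (\<Union>i. U i) \<and> (\<forall>i. bounded (U i) \<and> diameter (U i) \<le> \<delta>)}.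
        \<Sum>i. diam_pow s (U i))"

definition hausdorff_measure :: "real \<Rightarrow> 'a::metric_space set \<Rightarrow> ennreal" where
  "hausdorff_measure s A = (SUP \<delta> \<in> {0<..}. hausdorff_premeasure s \<delta> A)"

text \<open>The dimension is extended-real valued; it is \<open>\<infinity>\<close> if no exponent gives measure zero.\<close>

definition hausdorff_dim :: "'a::metric_space set \<Rightarrow> ereal" where
  "hausdorff_dim A = (INF s \<in> {s. 0 \<le> s \<and> hausdorff_measure s A = 0}. ereal s)"

text \<open>The plane attached to the polynomial \<open>(v x - u)\<^sup>2 = u\<^sup>2 - 2 u v x + v\<^sup>2 x\<^sup>2\<close>.\<close>

definition L_P :: "int \<Rightarrow> int \<Rightarrow> (real \<times> real \<times> real \<times> real) set" where
  "L_P u v = {(x0, x1, x2, x3).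
     (of_int u)\<^sup>2 * x0 - 2 * of_int u * of_int v * x1 + (of_int v)\<^sup>2 * x2 = 0 \<and>
     (of_int u)\<^sup>2 * x1 - 2 * of_int u * of_int v * x2 + (of_int v)\<^sup>2 * x3 = 0}"

definition special :: "int \<times> int \<times> int \<times> int \<Rightarrow> bool" where
  "special p \<longleftrightarrow> (case p of (p0, p1, p2, p3) \<Rightarrow>
     \<exists>u v. coprime u v \<and> (of_int p0, of_int p1, of_int p2, of_int p3) \<in> L_P u v)"

definition generic :: "int \<times> int \<times> int \<times> int \<Rightarrow> bool" where
  "generic p \<longleftrightarrow> \<not> special p"

definition S_g :: "real set \<Rightarrow> real \<Rightarrow> real set" where
  "S_g I lam = {x \<in> I. infinite {(p0, p1, p2, p3). 0 < p0 \<and> generic (p0, p1, p2, p3) \<and>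
     Max {\<bar>of_int p0 * x - of_int p1\<bar>,
          \<bar>of_int p0 * x ^ 2 - of_int p2\<bar>,
          \<bar>of_int p0 * x ^ 3 - of_int p3\<bar>} < of_int p0 powr (- lam)}}"

end

theory Submission
  imports Defs
begin

text \<open>
  An integral point \<open>p\<close> is read as a binary cubic form. Its discriminant \<open>D\<close> is an integer, which is
  nonzero if \<open>p\<close> is generic (\<open>special_if_disc_eq_0\<close>). Suppose \<open>lam > 1 / 3\<close> and let \<open>p\<close>, with \<open>p0\<close> of size
  \<open>Q\<close>, be within \<open>Q powr (- lam)\<close> of \<open>p0 (1, x, x\<^sup>2, x\<^sup>3)\<close>. The form is then close to \<open>p0 (X + x Y)\<^sup>3\<close>, and
  its invariants are small: \<open>0 < D \<le> K\<^sup>2\<close> and \<open>\<bar>p0 p2 - p1\<^sup>2\<bar> \<le> K\<close> with \<open>K\<close> of the order of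
  \<open>Q powr (1 - lam)\<close> (\<open>generic_in_near_curve\<close>).

  The heart of the matter is that at most about \<open>K\<^sup>2\<close>, up to powers of \<open>log K\<close>, integral forms satisfy
  these inequalities (\<open>card_near_curve_le\<close>). A form with positive discriminant is a sum
  \<open>l\<^sup>3 + m\<^sup>3\<close> of two cubes of real linear forms with \<open>D = d\<^sup>6\<close> for the determinant \<open>d\<close> of \<open>l\<close> and \<open>m\<close>
  (\<open>ex_cubes\<close>, \<open>disc_cubes\<close>). Two facts about the planar lattice of the pairs \<open>(l v, m v)\<close>, for integral \<open>v\<close>,
  finish the count.

    \<^item> A reduced basis of the lattice makes all coefficients of the form small, as in the work of
      Davenport on class numbers of cubic forms. Hence there are at most about \<open>Y log Y\<close> classes
      of forms with \<open>0 < D \<le> Y\<close> under integral substitutions of determinant one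
      (\<open>ex_reduced_equiv\<close>, \<open>card_reduced_nonzero\<close>, \<open>card_reduced_zero\<close>).
    \<^item> Within one class, the forms near the curve correspond to primitive vectors \<open>v\<close> in a thin sector
      at a prescribed distance from the origin. The slopes of such vectors are well separated, so a class contains at
      most about \<open>K / sqrt D + 1\<close> of them (\<open>card_dominant_le\<close>).

  Each form with \<open>p0\<close> of size \<open>Q\<close> serves the numbers \<open>x\<close> in an interval of length about
  \<open>Q powr (- 1 - lam)\<close> around \<open>p1 / p0\<close>. Summing the \<open>s\<close>-th powers of the lengths over \<open>Q = 2 ^ k\<close> gives a
  convergent series whenever \<open>(1 + lam) s > 2 - 2 lam\<close>, and the Borel--Cantelli principle
  (\<open>hausdorff_measure_limsup_eq_0\<close>) shows that the \<open>s\<close>-dimensional measure is zero.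
\<close>

section \<open>Sets of Hausdorff measure zero\<close>

text \<open>
  Covers below come as countable families of finite families, so they carry two indices; the
  pairing function turns such a family into the sequence that the definition asks for.
\<close>
lemma hausdorff_premeasure_le:
  fixes V :: "nat \<Rightarrow> nat \<Rightarrow> 'a::metric_space set"
  assumes "A \<subseteq> (\<Union>k j. V k j)" "\<And>k j. bounded (V k j)" "\<And>k j. diameter (V k j) \<le> \<delta>"
  shows "hausdorff_premeasure s \<delta> A \<le> (\<Sum>k. \<Sum>j. diam_pow s (V k j))"
proof -
  define U where "U n = V (fst (prod_decode n)) (snd (prod_decode n))" for n
  have "A \<subseteq> (\<Union>n. U n)"
  proof
    fix x assume "x \<in> A"
    then obtain k j where "x \<in> V k j" using assms(1) by blast
    then have "x \<in> U (prod_encode (k, j))" by (simp add: U_def)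
    then show "x \<in> (\<Union>n. U n)" by blast
  qed
  then have "hausdorff_premeasure s \<delta> A \<le> (\<Sum>n. diam_pow s (U n))"
    unfolding hausdorff_premeasure_def using assms(2,3) by (intro INF_lower) (auto simp: U_def)
  also have "\<dots> = (\<Sum>n. (case prod_decode n of (k, j) \<Rightarrow> diam_pow s (V k j)))"
    by (simp add: U_def case_prod_beta)
  also have "\<dots> = (\<Sum>k. \<Sum>j. diam_pow s (V k j))"
    using suminf_ennreal_2dimen[where f = "\<lambda>(k, j). diam_pow s (V k j)"] by (simp add: comp_def)
  finally show ?thesis .
qed

lemma hausdorff_premeasure_countable_UN_le:
  fixes A :: "nat \<Rightarrow> 'a::metric_space set"
  shows "hausdorff_premeasure s \<delta> (\<Union>n. A n) \<le> (\<Sum>n. hausdorff_premeasure s \<delta> (A n))"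
proof (rule ennreal_le_epsilon)
  fix e :: real assume e: "0 < e" and fin: "(\<Sum>n. hausdorff_premeasure s \<delta> (A n)) < top"
  define \<epsilon> where "\<epsilon> n = ennreal (e * (1 / 2) ^ Suc n)" for n
  define good where "good n U \<longleftrightarrow> A n \<subseteq> (\<Union>i. U i) \<and> (\<forall>i. bounded (U i) \<and> diameter (U i) \<le> \<delta>)
      \<and> (\<Sum>i. diam_pow s (U i)) < hausdorff_premeasure s \<delta> (A n) + \<epsilon> n" for n and U :: "nat \<Rightarrow> 'a set"
  have "\<exists>U. good n U" for n
  proof -
    have "hausdorff_premeasure s \<delta> (A n) \<le> (\<Sum>n. hausdorff_premeasure s \<delta> (A n))"
      using sum_le_suminf[of "\<lambda>n. hausdorff_premeasure s \<delta> (A n)" "{n}"] by simp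
    then obtain x where x: "hausdorff_premeasure s \<delta> (A n) = ennreal x" "0 \<le> x"
      using fin by (metis ennreal_cases less_top top_unique)
    then have "hausdorff_premeasure s \<delta> (A n) < hausdorff_premeasure s \<delta> (A n) + \<epsilon> n"
      using e by (simp add: \<epsilon>_def ennreal_less_iff flip: ennreal_plus)
    then show ?thesis
      unfolding good_def hausdorff_premeasure_def[of s \<delta> "A n"] INF_less_iff by blast
  qed
  then obtain U where "\<And>n. good n (U n)" by metis
  then have U: "\<And>n. A n \<subseteq> (\<Union>i. U n i)" "\<And>n i. bounded (U n i)" "\<And>n i. diameter (U n i) \<le> \<delta>"
    "\<And>n. (\<Sum>i. diam_pow s (U n i)) < hausdorff_premeasure s \<delta> (A n) + \<epsilon> n"
    unfolding good_def by blast+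
  have "hausdorff_premeasure s \<delta> (\<Union>n. A n) \<le> (\<Sum>n. \<Sum>i. diam_pow s (U n i))"
    by (rule hausdorff_premeasure_le[OF UN_mono[OF subset_refl U(1)] U(2,3)])
  also have "\<dots> \<le> (\<Sum>n. hausdorff_premeasure s \<delta> (A n) + \<epsilon> n)"
    by (intro suminf_le) (use U(4) in \<open>auto intro: less_imp_le\<close>)
  also have "\<dots> = (\<Sum>n. hausdorff_premeasure s \<delta> (A n)) + (\<Sum>n. \<epsilon> n)"
    by (rule suminf_add[symmetric]) auto
  also have "(\<Sum>n. \<epsilon> n) = ennreal e"
    unfolding \<epsilon>_def using sums_mult[OF power_half_series, of e] e
    by (subst suminf_ennreal_eq[of _ e]) auto
  finally show "hausdorff_premeasure s \<delta> (\<Union>n. A n) \<le> (\<Sum>n. hausdorff_premeasure s \<delta> (A n)) + ennreal e" .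
qed

lemma hausdorff_measure_eq_0_iff:
  "hausdorff_measure s A = 0 \<longleftrightarrow> (\<forall>\<delta>>0. hausdorff_premeasure s \<delta> A = 0)"
  unfolding hausdorff_measure_def bot_ennreal[symmetric]
  by (simp only: SUP_bot_conv Ball_def greaterThan_iff)

lemma hausdorff_measure_UN_eq_0:
  fixes A :: "nat \<Rightarrow> 'a::metric_space set"
  assumes "\<And>n. hausdorff_measure s (A n) = 0"
  shows "hausdorff_measure s (\<Union>n. A n) = 0"
  unfolding hausdorff_measure_eq_0_iff
proof (intro allI impI)
  fix \<delta> :: real assume "0 < \<delta>"
  then have "(\<Sum>n. hausdorff_premeasure s \<delta> (A n)) = 0"
    using assms by (simp add: hausdorff_measure_eq_0_iff)
  then show "hausdorff_premeasure s \<delta> (\<Union>n. A n) = 0"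
    using hausdorff_premeasure_countable_UN_le[of s \<delta> A] by simp
qed

lemma hausdorff_measure_mono:
  assumes "A \<subseteq> B" shows "hausdorff_measure s A \<le> hausdorff_measure s B"
  unfolding hausdorff_measure_def hausdorff_premeasure_def
  by (intro SUP_mono' INF_superset_mono) (use assms in auto)

text \<open>
  The Borel--Cantelli principle for Hausdorff measure: if the points of \<open>A\<close> lie in sets of
  infinitely many generations, the generations beyond any \<open>k\<close> still cover \<open>A\<close>, and the total
  weight of those generations is the tail of a convergent series.
\<close>
lemma hausdorff_measure_limsup_eq_0:
  fixes V :: "nat \<Rightarrow> 'i \<Rightarrow> 'a::metric_space set" and r :: "nat \<Rightarrow> real"
  assumes s: "0 < s" and fin: "\<And>k. finite (G k)"
    and bdd: "\<And>k i. i \<in> G k \<Longrightarrow> bounded (V k i)"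
    and diam: "\<And>k i. i \<in> G k \<Longrightarrow> diameter (V k i) \<le> r k"
    and r0: "\<And>k. 0 \<le> r k" and r: "r \<longlonglongrightarrow> 0"
    and sum: "summable (\<lambda>k. real (card (G k)) * r k powr s)"
    and A: "\<And>x. x \<in> A \<Longrightarrow> \<exists>\<^sub>\<infinity>k. x \<in> (\<Union>i\<in>G k. V k i)"
  shows "hausdorff_measure s A = 0"
  unfolding hausdorff_measure_eq_0_iff
proof (intro allI impI)
  fix \<delta> :: real assume \<delta>: "0 < \<delta>"
  have "hausdorff_premeasure s \<delta> A \<le> 0"
  proof (rule ennreal_le_epsilon)
    fix e :: real assume e: "0 < e"
    define c where "c k = real (card (G k)) * r k powr s" for k
    have c0: "0 \<le> c k" for k by (simp add: c_def)
    obtain k1 where k1: "\<And>k. k \<ge> k1 \<Longrightarrow> r k < \<delta>"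
      using order_tendstoD(2)[OF r \<delta>] unfolding eventually_sequentially by blast
    obtain k2 where k2: "\<And>k. k \<ge> k2 \<Longrightarrow> norm (\<Sum>i. c (i + k)) < e"
      using suminf_exist_split[OF e sum] unfolding c_def by blast
    define k0 where "k0 = max k1 k2"
    define W where "W k j = (if j < card (G (k + k0)) then V (k + k0) (from_nat_into (G (k + k0)) j) else {})" for k j
    have mem: "from_nat_into (G k) j \<in> G k" if "j < card (G k)" for k j
      using that by (intro from_nat_into) auto
    have sub: "A \<subseteq> (\<Union>k j. W k j)"
    proof
      fix x assume "x \<in> A"
      then obtain k where k: "k > k0" "x \<in> (\<Union>i\<in>G k. V k i)"
        using A unfolding INFM_nat by blast
      then obtain i where i: "i \<in> G k" "x \<in> V k i" by blast
      obtain j where j: "j < card (G k)" "from_nat_into (G k) j = i"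
        using bij_betw_from_nat_into_finite[OF fin[of k]] i(1) unfolding bij_betw_def by force
      have "x \<in> W (k - k0) j" using i j k by (simp add: W_def)
      then show "x \<in> (\<Union>k j. W k j)" by blast
    qed
    have "hausdorff_premeasure s \<delta> A \<le> (\<Sum>k. \<Sum>j. diam_pow s (W k j))"
    proof (rule hausdorff_premeasure_le[OF sub])
      show "bounded (W k j)" for k j using bdd mem by (auto simp: W_def)
      show "diameter (W k j) \<le> \<delta>" for k j
      proof (cases "j < card (G (k + k0))")
        case True
        have "diameter (W k j) \<le> r (k + k0)" using diam[OF mem[OF True]] True by (simp add: W_def)
        also have "\<dots> < \<delta>" by (rule k1) (simp add: k0_def)
        finally show ?thesis by simp
      qed (use \<delta> in \<open>simp add: W_def\<close>)
    qed
    also have "\<dots> \<le> (\<Sum>k. ennreal (c (k + k0)))"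
    proof (intro suminf_le)
      fix k
      have dp: "diam_pow s (W k j) \<le> (if j < card (G (k + k0)) then ennreal (r (k + k0) powr s) else 0)" for j
        using diam[OF mem, of j "k + k0"] s bdd[OF mem, of j "k + k0"]
        by (auto simp: W_def diam_pow_def intro!: ennreal_leI powr_mono2 diameter_ge_0)
      have "(\<Sum>j. diam_pow s (W k j)) \<le> (\<Sum>j. if j < card (G (k + k0)) then ennreal (r (k + k0) powr s) else 0)"
        by (intro suminf_le dp) auto
      also have "\<dots> = (\<Sum>j<card (G (k + k0)). ennreal (r (k + k0) powr s))"
        by (subst suminf_finite[of "{..<card (G (k + k0))}"]) auto
      also have "\<dots> = ennreal (c (k + k0))" by (simp add: c_def ennreal_mult ennreal_of_nat_eq_real_of_nat)
      finally show "(\<Sum>j. diam_pow s (W k j)) \<le> ennreal (c (k + k0))" .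
    qed auto
    also have "\<dots> = ennreal (\<Sum>k. c (k + k0))"
      by (intro suminf_ennreal2 c0 summable_ignore_initial_segment) (use sum in \<open>simp add: c_def\<close>)
    also have "\<dots> \<le> ennreal e" using k2[of k0] by (intro ennreal_leI) (simp add: k0_def)
    finally show "hausdorff_premeasure s \<delta> A \<le> 0 + ennreal e" by simp
  qed
  then show "hausdorff_premeasure s \<delta> A = 0" by simp
qed

lemma hausdorff_dim_le:
  assumes "0 \<le> D" "\<And>s. D < s \<Longrightarrow> hausdorff_measure s A = 0"
  shows "hausdorff_dim A \<le> ereal D"
proof (rule ereal_le_epsilon2)
  fix e :: real assume "0 < e"
  then show "hausdorff_dim A \<le> ereal D + ereal e"
    unfolding hausdorff_dim_def plus_ereal.simps using assms by (intro INF_lower) auto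
qed

section \<open>Integral points as binary cubic forms\<close>

text \<open>
  The point \<open>(p0, p1, p2, p3)\<close> stands for the binary cubic form
  \<open>p0 X\<^sup>3 + 3 p1 X\<^sup>2 Y + 3 p2 X Y\<^sup>2 + p3 Y\<^sup>3\<close>; the points \<open>(1, x, x\<^sup>2, x\<^sup>3)\<close> of the curve are the
  cubes \<open>(X + x Y)\<^sup>3\<close>.
\<close>
type_synonym cubic = "int \<times> int \<times> int \<times> int"

text \<open>
  Up to a constant factor this is the discriminant of the cubic form. It is written here as the
  discriminant of its Hessian \<open>C X\<^sup>2 + B X Y + A Y\<^sup>2\<close>, where \<open>A = p1 p3 - p2\<^sup>2\<close>, \<open>B = p0 p3 - p1 p2\<close>
  and \<open>C = p0 p2 - p1\<^sup>2\<close>.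
\<close>
fun disc :: "cubic \<Rightarrow> int" where
  "disc (p0, p1, p2, p3) = (p0 * p3 - p1 * p2)\<^sup>2 - 4 * (p0 * p2 - p1\<^sup>2) * (p1 * p3 - p2\<^sup>2)"

text \<open>
  The vector \<open>(A, - B, C)\<close> of Hessian coefficients is the cross product of \<open>(p0, p1, p2)\<close> and
  \<open>(p1, p2, p3)\<close>, hence orthogonal to both. If \<open>B\<^sup>2 = 4 A C\<close> and \<open>C \<noteq> 0\<close>, it is proportional to
  \<open>(B\<^sup>2, - 2 B (2 C), (2 C)\<^sup>2)\<close>, which has the shape \<open>(u\<^sup>2, - 2 u v, v\<^sup>2)\<close> required of a special
  point; only a common factor of \<open>B\<close> and \<open>2 C\<close> has to be removed. If \<open>C = 0\<close>, the whole Hessian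
  vanishes, the form is a multiple of the cube of a rational linear form, and \<open>u / v = p1 / p0\<close> works.
\<close>
lemma special_if_disc_eq_0:
  assumes "disc (p0, p1, p2, p3) = 0" "p0 \<noteq> 0"
  shows "special (p0, p1, p2, p3)"
proof -
  define A where "A = p1 * p3 - p2\<^sup>2"
  define B where "B = p0 * p3 - p1 * p2"
  define C where "C = p0 * p2 - p1\<^sup>2"
  have disc: "B\<^sup>2 = 4 * C * A" using assms by (simp add: A_def B_def C_def)
  obtain U V :: int where nz: "V \<noteq> 0"
    and eq1: "U\<^sup>2 * p0 - 2 * U * V * p1 + V\<^sup>2 * p2 = 0"
    and eq2: "U\<^sup>2 * p1 - 2 * U * V * p2 + V\<^sup>2 * p3 = 0"
  proof (cases "C = 0")
    case True
    then have "p0 * p2 = p1\<^sup>2" "p0 * p3 = p1 * p2" using disc by (auto simp: B_def C_def)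
    then have "p1\<^sup>2 * p0 - 2 * p1 * p0 * p1 + p0\<^sup>2 * p2 = 0"
      "p1\<^sup>2 * p1 - 2 * p1 * p0 * p2 + p0\<^sup>2 * p3 = 0"
      by algebra+
    then show ?thesis using that assms(2) by blast
  next
    case False
    have "B\<^sup>2 * p0 - 2 * B * (2 * C) * p1 + (2 * C)\<^sup>2 * p2 = 4 * C * (A * p0 - B * p1 + C * p2)"
      using disc by algebra
    also have "A * p0 - B * p1 + C * p2 = 0" unfolding A_def B_def C_def by algebra
    finally have e1: "B\<^sup>2 * p0 - 2 * B * (2 * C) * p1 + (2 * C)\<^sup>2 * p2 = 0" by simp
    have "B\<^sup>2 * p1 - 2 * B * (2 * C) * p2 + (2 * C)\<^sup>2 * p3 = 4 * C * (A * p1 - B * p2 + C * p3)"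
      using disc by algebra
    also have "A * p1 - B * p2 + C * p3 = 0" unfolding A_def B_def C_def by algebra
    finally have e2: "B\<^sup>2 * p1 - 2 * B * (2 * C) * p2 + (2 * C)\<^sup>2 * p3 = 0" by simp
    show ?thesis using that[of "2 * C" B] e1 e2 False by simp
  qed
  define g where "g = gcd U V"
  have g: "g \<noteq> 0" using nz by (simp add: g_def)
  obtain u v where uv: "U = u * g" "V = v * g" "coprime u v"
    using gcd_coprime_exists[of U V] g unfolding g_def by auto
  have "g\<^sup>2 * (u\<^sup>2 * p0 - 2 * u * v * p1 + v\<^sup>2 * p2) = 0" "g\<^sup>2 * (u\<^sup>2 * p1 - 2 * u * v * p2 + v\<^sup>2 * p3) = 0"
    using eq1 eq2 unfolding uv by algebra+
  then have "u\<^sup>2 * p0 - 2 * u * v * p1 + v\<^sup>2 * p2 = 0" "u\<^sup>2 * p1 - 2 * u * v * p2 + v\<^sup>2 * p3 = 0"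
    using g by simp_all
  then have "real_of_int (u\<^sup>2 * p0 - 2 * u * v * p1 + v\<^sup>2 * p2) = 0"
     "real_of_int (u\<^sup>2 * p1 - 2 * u * v * p2 + v\<^sup>2 * p3) = 0" by simp_all
  then show ?thesis unfolding special_def L_P_def using uv(3) by auto
qed

text \<open>
  The symmetric trilinear form whose value on the diagonal is the cubic form.
\<close>
fun polar :: "cubic \<Rightarrow> int \<times> int \<Rightarrow> int \<times> int \<Rightarrow> int \<times> int \<Rightarrow> int" where
  "polar (p0, p1, p2, p3) (x1, y1) (x2, y2) (x3, y3) =
     p0 * x1 * x2 * x3 + p1 * (x1 * x2 * y3 + x1 * y2 * x3 + y1 * x2 * x3)
     + p2 * (x1 * y2 * y3 + y1 * x2 * y3 + y1 * y2 * x3) + p3 * y1 * y2 * y3"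

text \<open>
  The coefficients of the form in the coordinates given by the vectors \<open>v\<close> and \<open>w\<close>; they are
  polarisations, and this is why the binomial coefficients are kept out of the coefficients.
\<close>
definition subst :: "cubic \<Rightarrow> int \<times> int \<Rightarrow> int \<times> int \<Rightarrow> cubic" where
  "subst p v w = (polar p v v v, polar p v v w, polar p v w w, polar p w w w)"

fun det2 :: "'a::comm_ring_1 \<times> 'a \<Rightarrow> 'a \<times> 'a \<Rightarrow> 'a" where
  "det2 (a, a') (b, b') = a * b' - a' * b"

fun lin :: "real \<times> real \<Rightarrow> int \<times> int \<Rightarrow> real" where
  "lin (a, a') (x, y) = a * of_int x + a' * of_int y"

text \<open>
  The form is \<open>(a X + a' Y)\<^sup>3 + (b X + b' Y)\<^sup>3\<close>. In such a decomposition a substitution acts on the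
  two linear forms separately, so that questions about cubic forms become questions about the
  planar lattice of the values of a pair of linear forms.
\<close>
fun cubes :: "cubic \<Rightarrow> real \<times> real \<Rightarrow> real \<times> real \<Rightarrow> bool" where
  "cubes (p0, p1, p2, p3) (a, a') (b, b') \<longleftrightarrow>
     of_int p0 = a ^ 3 + b ^ 3 \<and> of_int p1 = a\<^sup>2 * a' + b\<^sup>2 * b' \<and>
     of_int p2 = a * a'\<^sup>2 + b * b'\<^sup>2 \<and> of_int p3 = a' ^ 3 + b' ^ 3"

text \<open>
  The Hessian of a sum of two cubes is the product of the two linear forms times the square of
  their determinant; this is its leading coefficient.
\<close>
lemma hessian_cubes:
  assumes "cubes (p0, p1, p2, p3) (a, a') (b, b')"
  shows "of_int (p0 * p2 - p1\<^sup>2) = a * b * (det2 (a, a') (b, b'))\<^sup>2"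
proof -
  have "of_int (p0 * p2 - p1\<^sup>2) = (a ^ 3 + b ^ 3) * (a * a'\<^sup>2 + b * b'\<^sup>2) - (a\<^sup>2 * a' + b\<^sup>2 * b')\<^sup>2"
    using assms by simp
  also have "\<dots> = a * b * (det2 (a, a') (b, b'))\<^sup>2" unfolding det2.simps by algebra
  finally show ?thesis .
qed

lemma disc_cubes:
  assumes "cubes p l m"
  shows "of_int (disc p) = (det2 l m) ^ 6"
proof -
  obtain p0 p1 p2 p3 where p: "p = (p0, p1, p2, p3)" by (cases p)
  obtain a a' b b' where lm: "l = (a, a')" "m = (b, b')" by (cases l, cases m)
  define d where "d = a * b' - a' * b"
  have c: "of_int p0 = a ^ 3 + b ^ 3" "of_int p1 = a\<^sup>2 * a' + b\<^sup>2 * b'"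
     "of_int p2 = a * a'\<^sup>2 + b * b'\<^sup>2" "of_int p3 = a' ^ 3 + b' ^ 3"
    using assms unfolding p lm by auto
  have C: "of_int p0 * of_int p2 - (of_int p1)\<^sup>2 = a * b * d\<^sup>2" unfolding c d_def by algebra
  have A: "of_int p1 * of_int p3 - (of_int p2)\<^sup>2 = a' * b' * d\<^sup>2" unfolding c d_def by algebra
  have B: "of_int p0 * of_int p3 - of_int p1 * of_int p2 = (a * b' + a' * b) * d\<^sup>2"
    unfolding c d_def by algebra
  have "of_int (disc p) = (of_int p0 * of_int p3 - of_int p1 * of_int p2)\<^sup>2
      - 4 * (of_int p0 * of_int p2 - (of_int p1)\<^sup>2) * (of_int p1 * of_int p3 - (real_of_int p2)\<^sup>2)"
    unfolding p by simp
  also have "\<dots> = ((a * b' + a' * b) * d\<^sup>2)\<^sup>2 - 4 * (a * b * d\<^sup>2) * (a' * b' * d\<^sup>2)"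
    unfolding A B C ..
  also have "\<dots> = d ^ 4 * ((a * b' + a' * b)\<^sup>2 - 4 * (a * b) * (a' * b'))" by algebra
  also have "(a * b' + a' * b)\<^sup>2 - 4 * (a * b) * (a' * b') = d\<^sup>2" unfolding d_def by algebra
  also have "d ^ 4 * d\<^sup>2 = d ^ 6" by algebra
  finally show ?thesis by (simp add: lm d_def)
qed

lemma cubes_subst:
  assumes "cubes p l m"
  shows "cubes (subst p v w) (lin l v, lin l w) (lin m v, lin m w)"
proof -
  obtain p0 p1 p2 p3 where p: "p = (p0, p1, p2, p3)" by (cases p)
  obtain a a' b b' where lm: "l = (a, a')" "m = (b, b')" by (cases l, cases m)
  obtain v1 v2 w1 w2 where vw: "v = (v1, v2)" "w = (w1, w2)" by (cases v, cases w)
  have c: "of_int p0 = a ^ 3 + b ^ 3" "of_int p1 = a\<^sup>2 * a' + b\<^sup>2 * b'"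
     "of_int p2 = a * a'\<^sup>2 + b * b'\<^sup>2" "of_int p3 = a' ^ 3 + b' ^ 3"
    using assms unfolding p lm by auto
  show ?thesis unfolding p lm vw subst_def by (simp add: c; intro conjI; algebra)
qed

lemma det2_lin: "det2 (lin l v, lin l w) (lin m v, lin m w) = det2 l m * of_int (det2 v w)"
  by (cases l; cases m; cases v; cases w) (simp add: algebra_simps)

text \<open>
  An integral form is determined by its linear forms; in this way identities between integral
  substitutions are reduced to identities in the plane.
\<close>
lemma cubes_unique:
  assumes "cubes p l m" "cubes q l m"
  shows "p = q"
proof -
  obtain p0 p1 p2 p3 q0 q1 q2 q3 where p: "p = (p0, p1, p2, p3)" "q = (q0, q1, q2, q3)"
    by (cases p, cases q)
  obtain a a' b b' where lm: "l = (a, a')" "m = (b, b')" by (cases l, cases m)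
  have "real_of_int p0 = of_int q0" "real_of_int p1 = of_int q1"
       "real_of_int p2 = of_int q2" "real_of_int p3 = of_int q3"
    using assms unfolding p lm by auto
  then show ?thesis by (simp add: p)
qed

text \<open>
  Put \<open>d = D powr (1 / 6)\<close>. By the lemmas above, \<open>a\<^sup>3 + b\<^sup>3 = p0\<close> and \<open>(a b d\<^sup>2)\<^sup>3 = C\<^sup>3\<close>, so \<open>a\<^sup>3\<close> and \<open>b\<^sup>3\<close>
  are the roots of a quadratic polynomial. They are real because its discriminant is \<open>G\<^sup>2 / D\<close> by the
  classical syzygy \<open>G\<^sup>2 + 4 C\<^sup>3 = D p0\<^sup>2\<close> between the leading coefficients of the covariants. Then
  \<open>a'\<close> and \<open>b'\<close> solve the linear system formed by the equation for \<open>p1\<close> and \<open>a b' - a' b = d\<close>, and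
  the equations for \<open>p2\<close> and \<open>p3\<close> follow from the values of \<open>C\<close> and \<open>G\<close>.
\<close>
lemma ex_cubes:
  assumes D: "disc (p0, p1, p2, p3) > 0" and p0: "p0 \<noteq> 0"
  obtains l m where "cubes (p0, p1, p2, p3) l m" "det2 l m > 0"
proof -
  define r0 r1 r2 r3 where r: "r0 = real_of_int p0" "r1 = real_of_int p1"
    "r2 = real_of_int p2" "r3 = real_of_int p3"
  define Dr where "Dr = real_of_int (disc (p0, p1, p2, p3))"
  have Dr: "Dr > 0" using D by (simp add: Dr_def del: disc.simps)
  have Dr_eq: "Dr = (r0 * r3 - r1 * r2)\<^sup>2 - 4 * (r0 * r2 - r1\<^sup>2) * (r1 * r3 - r2\<^sup>2)"
    by (simp add: Dr_def r)
  have r0: "r0 \<noteq> 0" using p0 by (simp add: r)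
  define C where "C = r0 * r2 - r1\<^sup>2"
  \<comment> \<open>the leading coefficient of the cubic covariant; in terms of the cubes it is (a^3 - b^3) d^3\<close>
  define G where "G = r0\<^sup>2 * r3 - 3 * r0 * r1 * r2 + 2 * r1 ^ 3"
  have syzygy: "G\<^sup>2 + 4 * C ^ 3 = Dr * r0\<^sup>2" unfolding G_def C_def Dr_eq by algebra
  define E where "E = sqrt Dr"
  define d where "d = root 3 E"
  have E: "E > 0" "E\<^sup>2 = Dr" using Dr by (auto simp: E_def)
  have d: "d > 0" "d ^ 3 = E" using E by (auto simp: d_def)
  have d6: "d ^ 6 = Dr" using E d power_mult[of d 3 2] by simp
  define a where "a = root 3 ((r0 + G / E) / 2)"
  define b where "b = root 3 ((r0 - G / E) / 2)"
  have a3: "a ^ 3 = (r0 + G / E) / 2" and b3: "b ^ 3 = (r0 - G / E) / 2"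
    by (simp_all add: a_def b_def odd_real_root_pow)
  have s: "a ^ 3 + b ^ 3 = r0" and t: "(a ^ 3 - b ^ 3) * d ^ 3 = G"
    using E by (simp_all add: a3 b3 d field_simps)
  have "4 * (a * b * d\<^sup>2) ^ 3 = ((a ^ 3 + b ^ 3)\<^sup>2 - (a ^ 3 - b ^ 3)\<^sup>2) * d ^ 6" by algebra
  also have "\<dots> = r0\<^sup>2 * d ^ 6 - ((a ^ 3 - b ^ 3) * d ^ 3)\<^sup>2" unfolding s by algebra
  also have "\<dots> = 4 * C ^ 3" unfolding t d6 using syzygy by (simp add: algebra_simps)
  finally have "(a * b * d\<^sup>2) ^ 3 = C ^ 3" by simp
  then have C: "a * b * d\<^sup>2 = C" by (metis odd_real_root_power_cancel odd_numeral)
  \<comment> \<open>Cramer's rule; the determinant of the system is a^3 + b^3 = r0.\<close>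
  define a' where "a' = (a * r1 - b\<^sup>2 * d) / r0"
  define b' where "b' = (b * r1 + a\<^sup>2 * d) / r0"
  have a': "r0 * a' = a * r1 - b\<^sup>2 * d" and b': "r0 * b' = b * r1 + a\<^sup>2 * d"
    using r0 by (simp_all add: a'_def b'_def)
  have "r0 * (a\<^sup>2 * a' + b\<^sup>2 * b') = r0 * r1" using a' b' s by algebra
  then have e1: "a\<^sup>2 * a' + b\<^sup>2 * b' = r1" using r0 by simp
  have "r0 * (a * b' - a' * b) = r0 * d" using a' b' s by algebra
  then have ed: "a * b' - a' * b = d" using r0 by simp
  have "r0 * (a * a'\<^sup>2 + b * b'\<^sup>2) - r1\<^sup>2 = a * b * d\<^sup>2"
    unfolding s[symmetric] e1[symmetric] ed[symmetric] by algebra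
  then have "r0 * (a * a'\<^sup>2 + b * b'\<^sup>2) = r0 * r2" using C by (simp add: C_def)
  then have e2: "a * a'\<^sup>2 + b * b'\<^sup>2 = r2" using r0 by simp
  have "r0\<^sup>2 * (a' ^ 3 + b' ^ 3) - 3 * r0 * r1 * r2 + 2 * r1 ^ 3 = (a ^ 3 - b ^ 3) * d ^ 3"
    unfolding s[symmetric] e1[symmetric] e2[symmetric] ed[symmetric] by algebra
  then have "r0\<^sup>2 * (a' ^ 3 + b' ^ 3) = r0\<^sup>2 * r3" using t by (simp add: G_def)
  then have e3: "a' ^ 3 + b' ^ 3 = r3" using r0 by simp
  show ?thesis
    using that[of "(a, a')" "(b, b')"] s e1 e2 e3 ed d by (simp add: r)
qed

section \<open>Reduction of cubic forms\<close>

text \<open>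
  Lagrange reduction of the planar lattice of the pairs \<open>(lin l v, lin m v)\<close>. Among all bases of
  determinant one, choose one that minimises the sum of the two squared lengths; the minimum exists
  because only finitely many integral vectors have bounded length. Comparison with the bases
  \<open>(v, w \<plusminus> v)\<close> and \<open>(v \<plusminus> w, w)\<close> bounds the inner product by half of both squared lengths, and
  the identity of Lagrange turns this into a bound for their product.
\<close>
lemma ex_minimal_basis:
  fixes l m :: "real \<times> real"
  defines "N \<equiv> \<lambda>v. (lin l v)\<^sup>2 + (lin m v)\<^sup>2"
  assumes d: "det2 l m > 0"
  obtains v w where "det2 v w = 1" "N v \<le> N w" "N v * N w \<le> 4 / 3 * (det2 l m)\<^sup>2"
proof -
  obtain a a' b b' where lm: "l = (a, a')" "m = (b, b')" by (cases l, cases m)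
  define D where "D = a * b' - a' * b"
  have D: "D > 0" using d by (simp add: lm D_def)
  have fin: "finite {v. N v \<le> T}" for T
  proof -
    define B where "B = \<lceil>(\<bar>a\<bar> + \<bar>a'\<bar> + \<bar>b\<bar> + \<bar>b'\<bar>) * (1 + T) / D\<rceil>"
    have "{v. N v \<le> T} \<subseteq> {-B..B} \<times> {-B..B}"
    proof (rule subrelI)
      fix x y assume "(x, y) \<in> {v. N v \<le> T}"
      then have N: "N (x, y) \<le> T" by simp
      define s t where st: "s = lin l (x, y)" "t = lin m (x, y)"
      have "s\<^sup>2 + t\<^sup>2 \<le> T" using N by (simp add: N_def st)
      moreover have "2 * \<bar>s\<bar> \<le> 1 + s\<^sup>2" "2 * \<bar>t\<bar> \<le> 1 + t\<^sup>2"
        using zero_le_power2[of "\<bar>s\<bar> - 1"] zero_le_power2[of "\<bar>t\<bar> - 1"]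
        by (simp_all add: power2_diff)
      moreover have "0 \<le> s\<^sup>2" "0 \<le> t\<^sup>2" by simp_all
      ultimately have sT: "\<bar>s\<bar> \<le> 1 + T" and tT: "\<bar>t\<bar> \<le> 1 + T" by linarith+
      have "D * of_int x = b' * s - a' * t" "D * of_int y = a * t - b * s"
        by (simp_all add: D_def st lm algebra_simps)
      moreover have "\<bar>b' * s - a' * t\<bar> \<le> \<bar>b'\<bar> * (1 + T) + \<bar>a'\<bar> * (1 + T)"
        using mult_left_mono[OF sT, of "\<bar>b'\<bar>"] mult_left_mono[OF tT, of "\<bar>a'\<bar>"]
          abs_triangle_ineq4[of "b' * s" "a' * t"] by (simp add: abs_mult)
      moreover have "\<bar>a * t - b * s\<bar> \<le> \<bar>a\<bar> * (1 + T) + \<bar>b\<bar> * (1 + T)"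
        using mult_left_mono[OF sT, of "\<bar>b\<bar>"] mult_left_mono[OF tT, of "\<bar>a\<bar>"]
          abs_triangle_ineq4[of "a * t" "b * s"] by (simp add: abs_mult)
      moreover have "0 \<le> \<bar>a\<bar> * (1 + T)" "0 \<le> \<bar>a'\<bar> * (1 + T)" "0 \<le> \<bar>b\<bar> * (1 + T)" "0 \<le> \<bar>b'\<bar> * (1 + T)"
        using sT by auto
      ultimately have "\<bar>D * of_int x\<bar> \<le> (\<bar>a\<bar> + \<bar>a'\<bar> + \<bar>b\<bar> + \<bar>b'\<bar>) * (1 + T)"
          "\<bar>D * of_int y\<bar> \<le> (\<bar>a\<bar> + \<bar>a'\<bar> + \<bar>b\<bar> + \<bar>b'\<bar>) * (1 + T)"
        unfolding distrib_right by linarith+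
      then have "\<bar>real_of_int x\<bar> \<le> (\<bar>a\<bar> + \<bar>a'\<bar> + \<bar>b\<bar> + \<bar>b'\<bar>) * (1 + T) / D"
          "\<bar>real_of_int y\<bar> \<le> (\<bar>a\<bar> + \<bar>a'\<bar> + \<bar>b\<bar> + \<bar>b'\<bar>) * (1 + T) / D"
        using D by (simp_all add: abs_mult field_simps)
      then have "\<bar>x\<bar> \<le> B" "\<bar>y\<bar> \<le> B" unfolding B_def by linarith+
      then show "(x, y) \<in> {-B..B} \<times> {-B..B}" by auto
    qed
    then show ?thesis by (rule finite_subset) simp
  qed
  define f where "f = (\<lambda>(v, w). N v + N w)"
  define T where "T = f ((1, 0), (0, 1))"
  define S where "S = {(v, w). det2 v w = 1 \<and> N v + N w \<le> T}"
  have N0: "0 \<le> N v" for v by (simp add: N_def)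
  have "S \<subseteq> {v. N v \<le> T} \<times> {v. N v \<le> T}"
    unfolding S_def using N0 by (auto intro: order_trans[rotated])
  then have "finite S" by (rule finite_subset) (simp add: fin)
  moreover have "((1, 0), (0, 1)) \<in> S" by (simp add: S_def T_def f_def)
  ultimately obtain z where z: "z \<in> S" "\<And>z'. z' \<in> S \<Longrightarrow> f z \<le> f z'"
    using ex_min_if_finite[of "f ` S"] by (metis (no_types, lifting) empty_iff finite_imageI imageE image_eqI image_is_empty linorder_not_less)
  obtain v w where vw: "z = (v, w)" by (cases z)
  have det: "det2 v w = 1" using z(1) by (simp add: S_def vw)
  have min: "N v + N w \<le> N v' + N w'" if "det2 v' w' = 1" for v' w'
  proof (cases "N v' + N w' \<le> T")
    case True
    then show ?thesis using z(2)[of "(v', w')"] that by (simp add: S_def f_def vw)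
  next
    case False
    then show ?thesis using z(1) by (simp add: S_def vw)
  qed
  define P where "P = lin l v * lin l w + lin m v * lin m w"
  obtain v1 v2 w1 w2 where c: "v = (v1, v2)" "w = (w1, w2)" by (cases v, cases w)
  have add: "N (x1 + y1, x2 + y2) = N (x1, x2) + N (y1, y2)
      + 2 * (lin l (x1, x2) * lin l (y1, y2) + lin m (x1, x2) * lin m (y1, y2))"
    and sub: "N (x1 - y1, x2 - y2) = N (x1, x2) + N (y1, y2)
      - 2 * (lin l (x1, x2) * lin l (y1, y2) + lin m (x1, x2) * lin m (y1, y2))" for x1 x2 y1 y2
    unfolding N_def lm by (simp_all add: power2_eq_square algebra_simps)
  have PP: "lin l (w1, w2) * lin l (v1, v2) + lin m (w1, w2) * lin m (v1, v2) = P"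
     "lin l (v1, v2) * lin l (w1, w2) + lin m (v1, v2) * lin m (w1, w2) = P"
    by (simp_all add: P_def c)
  have "N v + N w \<le> N v + N (w1 + v1, w2 + v2)" "N v + N w \<le> N v + N (w1 - v1, w2 - v2)"
    "N v + N w \<le> N (v1 + w1, v2 + w2) + N w" "N v + N w \<le> N (v1 - w1, v2 - w2) + N w"
    by (rule min; use det in \<open>simp add: c algebra_simps\<close>)+
  then have P: "\<bar>P\<bar> \<le> N v / 2" "\<bar>P\<bar> \<le> N w / 2" unfolding add sub PP c by linarith+
  have "P\<^sup>2 \<le> (N v / 2) * (N w / 2)"
    using mult_mono[OF P] N0[of v] by (simp add: power2_eq_square abs_mult[symmetric])
  moreover have "N v * N w - P\<^sup>2 = (det2 (lin l v, lin l w) (lin m v, lin m w))\<^sup>2"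
    unfolding N_def P_def det2.simps by algebra
  ultimately have prod: "N v * N w \<le> 4 / 3 * (det2 l m)\<^sup>2"
    unfolding det2_lin det by simp
  show ?thesis
  proof (cases "N v \<le> N w")
    case True
    then show ?thesis using that det prod by blast
  next
    case False
    have "N (-v1, -v2) = N v" by (simp add: N_def c lm power2_eq_square algebra_simps)
    then show ?thesis using that[of w "(-v1, -v2)"] det prod False by (simp add: c algebra_simps)
  qed
qed

text \<open>
  The sizes of the coefficients of a sum of two cubes in a basis whose vectors have lengths \<open>s\<close>
  and \<open>t\<close>.
\<close>
definition box :: "real \<Rightarrow> real \<Rightarrow> cubic set" where
  "box s t = {(p0, p1, p2, p3). \<bar>of_int p0\<bar> \<le> 2 * s ^ 3 \<and> \<bar>of_int p1\<bar> \<le> 2 * s\<^sup>2 * t \<and>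
     \<bar>of_int p2\<bar> \<le> 2 * s * t\<^sup>2 \<and> \<bar>of_int p3\<bar> \<le> 2 * t ^ 3}"

lemma box_mono: "0 \<le> s \<Longrightarrow> s \<le> s' \<Longrightarrow> 0 \<le> t \<Longrightarrow> t \<le> t' \<Longrightarrow> box s t \<subseteq> box s' t'"
proof -
  assume a: "0 \<le> s" "s \<le> s'" "0 \<le> t" "t \<le> t'"
  have "s ^ 3 \<le> s' ^ 3" "s\<^sup>2 * t \<le> s'\<^sup>2 * t'" "s * t\<^sup>2 \<le> s' * t'\<^sup>2" "t ^ 3 \<le> t' ^ 3"
    using a by (auto intro!: mult_mono power_mono)
  then show ?thesis unfolding box_def by (auto simp: mult.assoc)
qed

lemma cubes_in_box:
  assumes "cubes p (a, a') (b, b')" "a\<^sup>2 + b\<^sup>2 \<le> s\<^sup>2" "a'\<^sup>2 + b'\<^sup>2 \<le> t\<^sup>2" "0 \<le> s" "0 \<le> t"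
  shows "p \<in> box s t"
proof -
  obtain p0 p1 p2 p3 where p: "p = (p0, p1, p2, p3)" by (cases p)
  have "a\<^sup>2 \<le> s\<^sup>2" "b\<^sup>2 \<le> s\<^sup>2" "a'\<^sup>2 \<le> t\<^sup>2" "b'\<^sup>2 \<le> t\<^sup>2"
    using assms(2,3) zero_le_power2[of a] zero_le_power2[of b] zero_le_power2[of a'] zero_le_power2[of b']
    by linarith+
  then have ab: "\<bar>a\<bar> \<le> s" "\<bar>b\<bar> \<le> s" "\<bar>a'\<bar> \<le> t" "\<bar>b'\<bar> \<le> t"
    using assms(4,5) by (auto simp: abs_le_square_iff[symmetric])
  have "\<bar>a ^ 3\<bar> \<le> s ^ 3" "\<bar>b ^ 3\<bar> \<le> s ^ 3" "\<bar>a\<^sup>2 * a'\<bar> \<le> s\<^sup>2 * t" "\<bar>b\<^sup>2 * b'\<bar> \<le> s\<^sup>2 * t"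
    "\<bar>a * a'\<^sup>2\<bar> \<le> s * t\<^sup>2" "\<bar>b * b'\<^sup>2\<bar> \<le> s * t\<^sup>2" "\<bar>a' ^ 3\<bar> \<le> t ^ 3" "\<bar>b' ^ 3\<bar> \<le> t ^ 3"
    unfolding abs_mult power_abs by (intro mult_mono power_mono ab; use assms in simp)+
  then show ?thesis using assms(1) unfolding p box_def cubes.simps
    by (simp add: abs_triangle_ineq[THEN order_trans])
qed

definition equiv_cubic :: "cubic \<Rightarrow> cubic \<Rightarrow> bool" where
  "equiv_cubic F p \<longleftrightarrow> (\<exists>v w. det2 v w = 1 \<and> p = subst F v w)"

lemma equiv_cubic_subst:
  assumes "cubes p l m" "det2 v w = 1"
  shows "equiv_cubic (subst p v w) p"
proof -
  obtain v1 v2 w1 w2 where c: "v = (v1, v2)" "w = (w1, w2)" by (cases v, cases w)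
  obtain a a' b b' where lm: "l = (a, a')" "m = (b, b')" by (cases l, cases m)
  have det: "real_of_int v1 * of_int w2 - of_int v2 * of_int w1 = 1"
    using assms(2) unfolding c by (simp flip: of_int_mult of_int_diff)
  have inv: "(lin (lin k v, lin k w) (w2, - v2), lin (lin k v, lin k w) (- w1, v1)) = k" for k
  proof (cases k)
    case (Pair x y)
    have "(x * v1 + y * v2) * w2 - (x * w1 + y * w2) * v2 = x"
      "(x * w1 + y * w2) * v1 - (x * v1 + y * v2) * w1 = y"
      using det by algebra+
    then show ?thesis by (simp add: Pair c)
  qed
  have "cubes (subst (subst p v w) (w2, -v2) (-w1, v1)) l m"
    using cubes_subst[OF cubes_subst[OF assms(1), of v w], of "(w2, -v2)" "(-w1, v1)"]
    unfolding inv .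
  then have "p = subst (subst p v w) (w2, -v2) (-w1, v1)"
    using assms(1) cubes_unique by blast
  moreover have "det2 (w2, -v2) (-w1, v1) = 1" using assms(2) by (simp add: c algebra_simps)
  ultimately show ?thesis unfolding equiv_cubic_def by blast
qed

text \<open>
  The reduced forms with nonzero leading coefficient, for determinants \<open>d \<le> \<delta>\<close>: a basis as in
  \<open>ex_minimal_basis\<close> has lengths \<open>s \<le> t\<close> with \<open>s t \<le> 2 d\<close>.
\<close>
definition reduced_nonzero :: "real \<Rightarrow> cubic set" where
  "reduced_nonzero \<delta> = {F. fst F \<noteq> 0 \<and> (\<exists>s t. 0 < s \<and> s \<le> t \<and> s * t \<le> 2 * \<delta> \<and> F \<in> box s t)}"

text \<open>
  The reduced forms \<open>Y (3 b X\<^sup>2 + 3 c X Y + e Y\<^sup>2)\<close> with leading coefficient zero. Here the lattice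
  may have arbitrarily short vectors, but the translations \<open>X \<mapsto> X + k Y\<close> preserve the shape and normalise
  \<open>c\<close> modulo \<open>2 b\<close>. The last condition bounds the discriminant, which is linear in \<open>e\<close>.
\<close>
definition reduced_zero :: "real \<Rightarrow> cubic set" where
  "reduced_zero \<delta> = {(0, b, c, e) |b c e. b \<noteq> 0 \<and> of_int b ^ 2 \<le> 32 * \<delta> ^ 3 \<and>
      \<bar>c\<bar> \<le> \<bar>b\<bar> \<and> \<bar>real_of_int (4 * b ^ 3 * e - 3 * b\<^sup>2 * c\<^sup>2)\<bar> \<le> \<delta> ^ 6}"

lemma ex_int_translate:
  assumes "(b::int) \<noteq> 0" obtains k where "\<bar>c + 2 * k * b\<bar> \<le> \<bar>b\<bar>"
proof -
  \<comment> \<open>c + 2 k b is the residue of c modulo 2 b of least absolute value\<close>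
  define k where "k = round (- (of_int c / (2 * of_int b)) :: real)"
  have "\<bar>of_int k + of_int c / (2 * of_int b) :: real\<bar> \<le> 1 / 2"
    using of_int_round_abs_le[of "- (of_int c / (2 * of_int b)) :: real"] unfolding k_def by linarith
  then have "\<bar>of_int k + of_int c / (2 * of_int b) :: real\<bar> * \<bar>2 * of_int b\<bar> \<le> 1 / 2 * \<bar>2 * of_int b\<bar>"
    by (intro mult_right_mono) auto
  then have "\<bar>(of_int k + of_int c / (2 * of_int b)) * (2 * of_int b)\<bar> \<le> \<bar>real_of_int b\<bar>"
    unfolding abs_mult by simp
  also have "(of_int k + of_int c / (2 * of_int b)) * (2 * of_int b) = real_of_int (c + 2 * k * b)"
    using assms by (simp add: field_simps)
  finally have "\<bar>real_of_int (c + 2 * k * b)\<bar> \<le> \<bar>real_of_int b\<bar>" .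
  then have "\<bar>c + 2 * k * b\<bar> \<le> \<bar>b\<bar>" by linarith
  then show ?thesis using that by blast
qed

text \<open>
  A reduced basis of the planar lattice puts the form into a box. If the leading coefficient is
  zero, a translation makes the third coefficient small, and the bound for \<open>b\<close> comes from
  \<open>(s\<^sup>2 t)\<^sup>2 = (s t)\<^sup>2 s\<^sup>2 \<le> (s t)\<^sup>3\<close>.
\<close>
lemma ex_reduced_equiv:
  assumes p: "cubes p l m" and d: "0 < det2 l m" "det2 l m \<le> \<delta>"
  obtains F l' m' where "F \<in> reduced_nonzero \<delta> \<union> reduced_zero \<delta>" "equiv_cubic F p"
    "cubes F l' m'" "det2 l' m' = det2 l m"
proof -
  define N where "N v = (lin l v)\<^sup>2 + (lin m v)\<^sup>2" for v
  obtain v w where det: "det2 v w = 1" and vw: "N v \<le> N w" "N v * N w \<le> 4 / 3 * (det2 l m)\<^sup>2"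
    using ex_minimal_basis[OF d(1)] unfolding N_def by blast
  define s t where st: "s = sqrt (N v)" "t = sqrt (N w)"
  have N0: "0 \<le> N v" "0 \<le> N w" by (simp_all add: N_def)
  define F where "F = subst p v w"
  have c: "cubes F (lin l v, lin l w) (lin m v, lin m w)"
    unfolding F_def by (rule cubes_subst[OF p])
  have dF: "det2 (lin l v, lin l w) (lin m v, lin m w) = det2 l m" unfolding det2_lin det by simp
  have "real_of_int (disc F) = real_of_int (disc p)"
    using disc_cubes[OF c] disc_cubes[OF p] dF by simp
  then have disc: "disc F = disc p" by linarith
  have eq: "equiv_cubic F p" unfolding F_def by (rule equiv_cubic_subst[OF p det])
  have "N v \<noteq> 0"
  proof
    assume "N v = 0"
    then have "lin l v = 0" "lin m v = 0" unfolding N_def by (simp_all add: sum_power2_eq_zero_iff)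
    then show False using dF d(1) by simp
  qed
  then have s: "0 < s" using N0 by (simp add: st)
  have sle: "s \<le> t" using vw by (simp add: st)
  have "(s * t)\<^sup>2 \<le> 4 / 3 * (det2 l m)\<^sup>2" using vw N0 by (simp add: st power_mult_distrib)
  also have "\<dots> \<le> (2 * det2 l m)\<^sup>2" by (simp add: power_mult_distrib)
  finally have "s * t \<le> 2 * det2 l m" by (rule power2_le_imp_le) (use d in simp)
  then have stle: "s * t \<le> 2 * \<delta>" using d by simp
  have box: "F \<in> box s t"
    by (rule cubes_in_box[OF c]) (use N0 in \<open>simp_all add: st N_def\<close>)
  show ?thesis
  proof (cases "fst F = 0")
    case False
    then show ?thesis using that[OF _ eq c dF] s sle stle box unfolding reduced_nonzero_def by blast
  next
    case True
    obtain b c0 e0 where F: "F = (0, b, c0, e0)" using True by (cases F) auto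
    have "disc F \<noteq> 0" unfolding disc using disc_cubes[OF p] d(1)
      by (metis of_int_0 power_not_zero less_numeral_extra(3))
    \<comment> \<open>if b were zero as well, the discriminant would vanish\<close>
    then have b: "b \<noteq> 0" by (auto simp: F)
    obtain k where k: "\<bar>c0 + 2 * k * b\<bar> \<le> \<bar>b\<bar>" using ex_int_translate[OF b] .
    define F' where "F' = subst F (1, 0) (k, 1)"
    have c': "cubes F' (lin (lin l v, lin l w) (1, 0), lin (lin l v, lin l w) (k, 1))
        (lin (lin m v, lin m w) (1, 0), lin (lin m v, lin m w) (k, 1))"
      unfolding F'_def by (rule cubes_subst[OF c])
    have dF': "disc F' = disc F" unfolding F'_def F subst_def by simp algebra
    have eq': "equiv_cubic F' p"
    proof -
      define v' where "v' = v"
      define w' where "w' = (k * fst v + fst w, k * snd v + snd w)"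
      have "F' = subst p v' w'"
        by (rule cubes_unique[OF cubes_subst[OF c, of "(1,0)" "(k,1)", folded F'_def]])
          (use cubes_subst[OF p, of v' w'] in
            \<open>cases l; cases m; cases v; cases w; simp add: v'_def w'_def algebra_simps\<close>)
      moreover have "det2 v' w' = 1" using det by (cases v; cases w; simp add: v'_def w'_def algebra_simps)
      ultimately show ?thesis using equiv_cubic_subst[OF p] by simp
    qed
    have F': "F' = (0, b, c0 + 2 * k * b, snd (snd (snd F')))"
      by (simp add: F'_def F subst_def algebra_simps)
    define e where "e = snd (snd (snd F'))"
    have ss: "s * s \<le> 2 * \<delta>" using mult_left_mono[OF sle, of s] s stle by linarith
    have "\<bar>of_int b\<bar> \<le> 2 * s\<^sup>2 * t" using box by (simp add: F box_def)
    then have "(of_int b)\<^sup>2 \<le> (2 * s\<^sup>2 * t)\<^sup>2" by (metis abs_ge_zero power2_abs power_mono)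
    also have "\<dots> = 4 * (s * t)\<^sup>2 * (s * s)" by algebra
    also have "\<dots> \<le> 4 * (2 * \<delta>)\<^sup>2 * (2 * \<delta>)"
    proof -
      have "(s * t)\<^sup>2 * (s * s) \<le> (2 * \<delta>)\<^sup>2 * (2 * \<delta>)"
        by (rule mult_mono[OF power_mono[OF stle] ss]) (use s sle in auto)
      then show ?thesis by (simp only: mult.assoc mult_left_mono)
    qed
    also have "\<dots> = 32 * \<delta> ^ 3" by algebra
    finally have bb: "(of_int b)\<^sup>2 \<le> 32 * \<delta> ^ 3" .
    have "4 * b ^ 3 * e - 3 * b\<^sup>2 * (c0 + 2 * k * b)\<^sup>2 = disc F'"
      by (subst F') (simp add: e_def algebra_simps power2_eq_square power3_eq_cube)
    then have "real_of_int (4 * b ^ 3 * e - 3 * b\<^sup>2 * (c0 + 2 * k * b)\<^sup>2) = (det2 l m) ^ 6"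
      unfolding dF' disc using disc_cubes[OF p] by simp
    moreover have "(det2 l m) ^ 6 \<le> \<delta> ^ 6" using d by (intro power_mono) auto
    ultimately have "\<bar>real_of_int (4 * b ^ 3 * e - 3 * b\<^sup>2 * (c0 + 2 * k * b)\<^sup>2)\<bar> \<le> \<delta> ^ 6" by simp
    then have "F' \<in> reduced_zero \<delta>"
      unfolding reduced_zero_def using F' b bb k e_def by blast
    then show ?thesis using that[OF _ eq' c'] dF by (simp add: algebra_simps)
  qed
qed

section \<open>The number of reduced forms\<close>

lemma finite_int_abs_le: "finite {x::int. \<bar>real_of_int x\<bar> \<le> r}"
proof -
  have "{x::int. \<bar>real_of_int x\<bar> \<le> r} \<subseteq> {- \<lfloor>r\<rfloor>..\<lfloor>r\<rfloor>}" by (auto simp: le_floor_iff; linarith)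
  then show ?thesis by (rule finite_subset) simp
qed

lemma card_int_abs_le:
  assumes "0 \<le> r" shows "real (card {x::int. \<bar>real_of_int x\<bar> \<le> r}) \<le> 2 * r + 1"
proof -
  have "{x::int. \<bar>real_of_int x\<bar> \<le> r} \<subseteq> {- \<lfloor>r\<rfloor>..\<lfloor>r\<rfloor>}" by (auto simp: le_floor_iff; linarith)
  then have "card {x::int. \<bar>real_of_int x\<bar> \<le> r} \<le> card {- \<lfloor>r\<rfloor>..\<lfloor>r\<rfloor>}" by (intro card_mono) auto
  also have "real (card {- \<lfloor>r\<rfloor>..\<lfloor>r\<rfloor>}) = 2 * of_int \<lfloor>r\<rfloor> + 1" using assms by simp
  also have "\<dots> \<le> 2 * r + 1" by simp
  finally show ?thesis by simp
qed

lemma card_box: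
  assumes "1 \<le> s" "1 \<le> t"
  shows "finite (box s t)" "real (card (box s t)) \<le> 1296 * (s * t) ^ 6"
proof -
  define I where "I r = {x::int. \<bar>real_of_int x\<bar> \<le> r}" for r
  have box: "box s t = I (2 * s ^ 3) \<times> I (2 * s\<^sup>2 * t) \<times> I (2 * s * t\<^sup>2) \<times> I (2 * t ^ 3)"
    by (auto simp: box_def I_def)
  have fin: "finite (I r)" for r unfolding I_def by (rule finite_int_abs_le)
  show "finite (box s t)" unfolding box by (intro finite_cartesian_product fin)
  have card: "real (card (I (2 * r))) \<le> 6 * r" if "1 \<le> r" for r
    using card_int_abs_le[of "2 * r"] that unfolding I_def by simp
  have ge: "1 \<le> s ^ 3" "1 \<le> s\<^sup>2 * t" "1 \<le> s * t\<^sup>2" "1 \<le> t ^ 3"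
    using assms mult_mono[of 1 "s\<^sup>2" 1 t] mult_mono[of 1 s 1 "t\<^sup>2"] by auto
  have "real (card (box s t)) = real (card (I (2 * s ^ 3))) * (real (card (I (2 * (s\<^sup>2 * t))))
      * (real (card (I (2 * (s * t\<^sup>2)))) * real (card (I (2 * t ^ 3)))))"
    unfolding box by (simp add: card_cartesian_product mult.assoc)
  also have "\<dots> \<le> 6 * s ^ 3 * ((6 * (s\<^sup>2 * t)) * ((6 * (s * t\<^sup>2)) * (6 * t ^ 3)))"
    by (intro mult_mono card ge) (use assms in auto)
  also have "\<dots> = 1296 * (s * t) ^ 6" by algebra
  finally show "real (card (box s t)) \<le> 1296 * (s * t) ^ 6" .
qed

text \<open>
  An integer leading coefficient of size at least \<open>1\<close> and at most \<open>2 s\<^sup>3\<close> prevents \<open>s\<close> from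
  being small. Hence \<open>s\<close> lies in one of about \<open>log \<delta>\<close> dyadic ranges, and since \<open>s t\<close> is at
  most of the order of \<open>\<delta>\<close>, each range contributes a box with at most a constant times \<open>\<delta>\<^sup>6\<close>
  integral points (with the constant \<open>1296 * 4 ^ 6 = 5308416\<close>).
\<close>
lemma card_reduced_nonzero:
  assumes "1 \<le> \<delta>" "4 * \<delta> \<le> 2 ^ J"
  shows "finite (reduced_nonzero \<delta>)"
    "real (card (reduced_nonzero \<delta>)) \<le> (real J + 1) * 5308416 * \<delta> ^ 6"
proof -
  define U where "U j = (if 2 ^ j \<le> 4 * \<delta> then box (2 ^ j) (4 * \<delta> / 2 ^ j) else {})" for j :: nat
  have fin: "finite (U j)" for j
    unfolding U_def by (auto intro!: card_box simp: field_simps)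
  have card: "real (card (U j)) \<le> 5308416 * \<delta> ^ 6" for j
  proof (cases "2 ^ j \<le> 4 * \<delta>")
    case True
    then have "real (card (U j)) \<le> 1296 * (2 ^ j * (4 * \<delta> / 2 ^ j)) ^ 6"
      unfolding U_def by (simp only: if_True; intro card_box) (auto simp: field_simps)
    then show ?thesis by (simp add: power_mult_distrib)
  qed (use assms in \<open>simp add: U_def\<close>)
  have sub: "reduced_nonzero \<delta> \<subseteq> (\<Union>j\<in>{..J}. U j)"
  proof
    fix F assume "F \<in> reduced_nonzero \<delta>"
    then obtain s t where F: "fst F \<noteq> 0" "0 < s" "s \<le> t" "s * t \<le> 2 * \<delta>" "F \<in> box s t"
      unfolding reduced_nonzero_def by blast
    have "1 \<le> \<bar>real_of_int (fst F)\<bar>" using F(1) by (simp flip: of_int_abs)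
    also have "\<dots> \<le> 2 * s ^ 3" using F(5) by (auto simp: box_def)
    finally have "1 / 2 \<le> s ^ 3" by simp
    then have "(1 / 2) ^ 3 \<le> s ^ 3" by (simp add: power3_eq_cube)
    then have s: "1 / 2 \<le> s" using F(2) by (simp add: power_mono_iff)
    \<comment> \<open>the dyadic scale of s: it lies between s and 2 s\<close>
    define j where "j = (LEAST j. s \<le> 2 ^ j)"
    have "\<exists>j. s \<le> 2 ^ j" using real_arch_pow[of 2 s] by (auto intro: less_imp_le)
    then have j1: "s \<le> 2 ^ j" unfolding j_def by (rule LeastI_ex)
    have j2: "2 ^ j \<le> 2 * s"
    proof (cases j)
      case 0
      then show ?thesis using s by simp
    next
      case (Suc i)
      then have "\<not> s \<le> 2 ^ i" using not_less_Least[of i "\<lambda>j. s \<le> 2 ^ j"] unfolding j_def[symmetric] by simp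
      then show ?thesis by (simp add: Suc)
    qed
    have "s * s \<le> 2 * \<delta>" using F(2-4) mult_left_mono[of s t s] by linarith
    also have "\<dots> \<le> (2 * \<delta>) * (2 * \<delta>)" using assms by simp
    finally have "s\<^sup>2 \<le> (2 * \<delta>)\<^sup>2" by (simp add: power2_eq_square)
    then have "s \<le> 2 * \<delta>" by (rule power2_le_imp_le) (use assms in simp)
    then have le: "2 ^ j \<le> 4 * \<delta>" using j2 by simp
    have "t \<le> 2 * \<delta> / s" using F by (simp add: field_simps)
    also have "\<dots> \<le> 2 * \<delta> / (2 ^ j / 2)" using j2 F assms by (intro divide_left_mono) auto
    finally have "t \<le> 4 * \<delta> / 2 ^ j" by simp
    then have "F \<in> U j" using F box_mono[of s "2 ^ j" t "4 * \<delta> / 2 ^ j"] j1 le by (auto simp: U_def)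
    moreover have "(2::real) ^ j \<le> 2 ^ J" using le assms by linarith
    then have "j \<le> J" by simp
    ultimately show "F \<in> (\<Union>j\<in>{..J}. U j)" by blast
  qed
  have fU: "finite (\<Union>j\<in>{..J}. U j)" using fin by blast
  show "finite (reduced_nonzero \<delta>)" by (rule finite_subset[OF sub fU])
  have "card (reduced_nonzero \<delta>) \<le> card (\<Union>j\<in>{..J}. U j)" by (rule card_mono[OF fU sub])
  also have "\<dots> \<le> (\<Sum>j\<in>{..J}. card (U j))" by (rule card_UN_le) simp
  finally have "real (card (reduced_nonzero \<delta>)) \<le> (\<Sum>j\<in>{..J}. real (card (U j)))"
    by (simp flip: of_nat_sum)
  also have "\<dots> \<le> (\<Sum>j\<in>{..J}. 5308416 * \<delta> ^ 6)" by (rule sum_mono) (rule card)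
  finally show "real (card (reduced_nonzero \<delta>)) \<le> (real J + 1) * 5308416 * \<delta> ^ 6"
    by (simp add: algebra_simps)
qed

lemma sum_inverse_squares_le: "(\<Sum>n\<in>{1..N::nat}. 1 / (real n)\<^sup>2) \<le> 2"
proof -
  have "(\<Sum>n\<in>{1..Suc M}. 1 / (real n)\<^sup>2) \<le> 2 - 1 / real (Suc M)" for M
  proof (induction M)
    case (Suc M)
    have "1 / (real (Suc (Suc M)))\<^sup>2 \<le> 1 / (real (Suc M) * real (Suc (Suc M)))"
      unfolding power2_eq_square by (intro divide_left_mono mult_right_mono mult_pos_pos) auto
    also have "\<dots> = 1 / real (Suc M) - 1 / real (Suc (Suc M))"
      by (simp add: field_simps)
    finally have "1 / (real (Suc (Suc M)))\<^sup>2 \<le> 1 / real (Suc M) - 1 / real (Suc (Suc M))" .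
    then show ?case using Suc by simp
  qed simp
  from this[of "N - 1"] show ?thesis by (cases N) (auto intro: order_trans)
qed

lemma sum_int_inverse_squares_le:
  assumes "finite B" "0 \<notin> B" shows "(\<Sum>b\<in>B. 1 / (real_of_int b)\<^sup>2) \<le> 4"
proof -
  define N where "N = (\<Sum>b\<in>B. nat \<bar>b\<bar>)"
  have N: "nat \<bar>b\<bar> \<le> N" if "b \<in> B" for b
    unfolding N_def using member_le_sum[of b B "\<lambda>b. nat \<bar>b\<bar>"] that assms by simp
  have "B \<subseteq> int ` {1..N} \<union> (\<lambda>n. - int n) ` {1..N}"
  proof
    fix b assume b: "b \<in> B"
    have "b \<noteq> 0" using b assms by metis
    then have "nat \<bar>b\<bar> \<in> {1..N}" "b = int (nat \<bar>b\<bar>) \<or> b = - int (nat \<bar>b\<bar>)"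
      using N[OF b] by (auto simp: abs_if Suc_le_eq)
    then show "b \<in> int ` {1..N} \<union> (\<lambda>n. - int n) ` {1..N}" by blast
  qed
  then have "(\<Sum>b\<in>B. 1 / (real_of_int b)\<^sup>2)
      \<le> (\<Sum>b\<in>int ` {1..N} \<union> (\<lambda>n. - int n) ` {1..N}. 1 / (real_of_int b)\<^sup>2)"
    by (intro sum_mono2) auto
  also have "\<dots> = (\<Sum>b\<in>int ` {1..N}. 1 / (real_of_int b)\<^sup>2) + (\<Sum>b\<in>(\<lambda>n. - int n) ` {1..N}. 1 / (real_of_int b)\<^sup>2)"
    by (intro sum.union_disjoint) auto
  also have "\<dots> = (\<Sum>n\<in>{1..N}. 1 / (real n)\<^sup>2) + (\<Sum>n\<in>{1..N}. 1 / (real n)\<^sup>2)"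
    by (intro arg_cong2[where f = "(+)"]; subst sum.reindex) (auto simp: inj_on_def)
  also have "\<dots> \<le> 4" using sum_inverse_squares_le[of N] by linarith
  finally show ?thesis .
qed

text \<open>
  For given \<open>b\<close> there are of the order of \<open>b\<close> choices of \<open>c\<close>; then
  \<open>4 b\<^sup>3 e = D + 3 b\<^sup>2 c\<^sup>2\<close> and \<open>b\<^sup>4 \<le> 1024 \<delta>\<^sup>6\<close> leave of the order of \<open>\<delta>\<^sup>6 / b\<^sup>3\<close> choices of \<open>e\<close>.
  The sum of \<open>\<delta>\<^sup>6 / b\<^sup>2\<close> over \<open>b\<close> is a constant times \<open>\<delta>\<^sup>6\<close>.
\<close>
lemma card_reduced_zero:
  assumes "1 \<le> \<delta>"
  shows "finite (reduced_zero \<delta>)" "real (card (reduced_zero \<delta>)) \<le> 30744 * \<delta> ^ 6"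
proof -
  define B where "B = {b::int. b \<noteq> 0 \<and> (of_int b)\<^sup>2 \<le> 32 * \<delta> ^ 3}"
  define Cs where "Cs b = {c::int. \<bar>real_of_int c\<bar> \<le> \<bar>of_int b\<bar>}" for b :: int
  define Es where "Es b = {e::int. \<bar>real_of_int e\<bar> \<le> 769 * \<delta> ^ 6 / \<bar>of_int b\<bar> ^ 3}" for b :: int
  define S where "S = (SIGMA b:B. Cs b \<times> Es b)"
  have "\<bar>real_of_int b\<bar> \<le> 32 * \<delta> ^ 3" if "b \<in> B" for b
  proof -
    have "\<bar>real_of_int b\<bar> * 1 \<le> \<bar>real_of_int b\<bar> * \<bar>real_of_int b\<bar>"
      using that by (intro mult_left_mono) (auto simp: B_def simp flip: of_int_abs)
    then show ?thesis using that by (simp add: B_def power2_eq_square)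
  qed
  then have "B \<subseteq> {b. \<bar>real_of_int b\<bar> \<le> 32 * \<delta> ^ 3}" by blast
  then have finB: "finite B" by (rule finite_subset[OF _ finite_int_abs_le])
  have fin: "finite (Cs b)" "finite (Es b)" for b unfolding Cs_def Es_def by (rule finite_int_abs_le)+
  have finS: "finite S" unfolding S_def using finB fin by blast
  have b4: "(real_of_int b) ^ 4 \<le> 1024 * \<delta> ^ 6" if "b \<in> B" for b
  proof -
    have "((real_of_int b)\<^sup>2)\<^sup>2 \<le> (32 * \<delta> ^ 3)\<^sup>2" using that by (intro power_mono) (auto simp: B_def)
    then show ?thesis by (simp add: power_mult_distrib flip: power_mult)
  qed
  have sub: "reduced_zero \<delta> \<subseteq> (\<lambda>(b, c, e). (0, b, c, e)) ` S"
  proof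
    fix F assume "F \<in> reduced_zero \<delta>"
    then obtain b c e where F: "F = (0, b, c, e)" and b: "b \<in> B" and c: "\<bar>c\<bar> \<le> \<bar>b\<bar>"
      and e: "\<bar>real_of_int (4 * b ^ 3 * e - 3 * b\<^sup>2 * c\<^sup>2)\<bar> \<le> \<delta> ^ 6"
      unfolding reduced_zero_def B_def by auto
    have c': "\<bar>real_of_int c\<bar> \<le> \<bar>real_of_int b\<bar>" using c by linarith
    then have "(real_of_int c)\<^sup>2 \<le> (real_of_int b)\<^sup>2" by (simp add: abs_le_square_iff)
    then have "3 * (real_of_int b)\<^sup>2 * (real_of_int c)\<^sup>2 \<le> 3 * (real_of_int b)\<^sup>2 * (real_of_int b)\<^sup>2"
      by (intro mult_left_mono) auto
    also have "\<dots> = 3 * (real_of_int b) ^ 4" by algebra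
    also have "\<dots> \<le> 3072 * \<delta> ^ 6" using b4[OF b] by simp
    finally have "3 * (real_of_int b)\<^sup>2 * (real_of_int c)\<^sup>2 \<le> 3072 * \<delta> ^ 6" .
    moreover have "\<bar>4 * real_of_int b ^ 3 * of_int e - 3 * (real_of_int b)\<^sup>2 * (real_of_int c)\<^sup>2\<bar> \<le> \<delta> ^ 6"
      using e by simp
    moreover have "0 \<le> 3 * (real_of_int b)\<^sup>2 * (real_of_int c)\<^sup>2" by simp
    ultimately have "\<bar>4 * real_of_int b ^ 3 * of_int e\<bar> \<le> 3073 * \<delta> ^ 6" by linarith
    moreover have "\<bar>4 * real_of_int b ^ 3 * of_int e\<bar> = 4 * (\<bar>real_of_int e\<bar> * \<bar>of_int b\<bar> ^ 3)"
      by (simp add: abs_mult power_abs)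
    moreover have "0 \<le> \<delta> ^ 6" using assms by simp
    ultimately have "\<bar>real_of_int e\<bar> * \<bar>of_int b\<bar> ^ 3 \<le> 769 * \<delta> ^ 6" by linarith
    then have "e \<in> Es b" using b by (simp add: Es_def B_def field_simps)
    then show "F \<in> (\<lambda>(b, c, e). (0, b, c, e)) ` S" using b c' by (force simp: F S_def Cs_def)
  qed
  show "finite (reduced_zero \<delta>)" by (rule finite_subset[OF sub]) (use finS in simp)
  have "card (reduced_zero \<delta>) \<le> card ((\<lambda>(b, c, e). (0::int, b, c, e)) ` S)"
    by (rule card_mono[OF _ sub]) (use finS in simp)
  also have "\<dots> \<le> card S" by (rule card_image_le[OF finS])
  also have "card S = (\<Sum>b\<in>B. card (Cs b) * card (Es b))"
    unfolding S_def by (subst card_SigmaI) (use finB fin in \<open>auto simp: card_cartesian_product\<close>)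
  finally have "real (card (reduced_zero \<delta>)) \<le> (\<Sum>b\<in>B. real (card (Cs b)) * real (card (Es b)))"
    by (simp flip: of_nat_sum of_nat_mult)
  also have "\<dots> \<le> (\<Sum>b\<in>B. 7686 * \<delta> ^ 6 * (1 / (real_of_int b)\<^sup>2))"
  proof (rule sum_mono)
    fix b assume b: "b \<in> B"
    define x where "x = \<bar>real_of_int b\<bar>"
    have "1 \<le> \<bar>b\<bar>" using b by (auto simp: B_def)
    then have x: "1 \<le> x" unfolding x_def by linarith
    have "x ^ 3 \<le> x ^ 4" using x by (intro power_increasing) auto
    also have "x ^ 4 \<le> 1024 * \<delta> ^ 6" using b4[OF b] by (simp add: x_def)
    \<comment> \<open>this absorbs the 1 in the number of choices of e: 2 * 769 + 1024 = 2562\<close>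
    finally have one: "1 \<le> 1024 * \<delta> ^ 6 / x ^ 3" using x by (simp add: field_simps)
    have "real (card (Cs b)) \<le> 3 * x" using card_int_abs_le[of x] x unfolding Cs_def x_def by linarith
    moreover have "real (card (Es b)) \<le> 2 * (769 * \<delta> ^ 6 / x ^ 3) + 1"
      using card_int_abs_le[of "769 * \<delta> ^ 6 / x ^ 3"] x assms unfolding Es_def x_def by simp
    moreover have "2 * (769 * \<delta> ^ 6 / x ^ 3) + 1 \<le> 2562 * \<delta> ^ 6 / x ^ 3" using one by simp
    ultimately have "real (card (Cs b)) * real (card (Es b)) \<le> 3 * x * (2562 * \<delta> ^ 6 / x ^ 3)"
      using x by (intro mult_mono) auto
    also have "\<dots> = 7686 * \<delta> ^ 6 * (1 / x\<^sup>2)" using x by (simp add: field_simps power2_eq_square power3_eq_cube)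
    finally show "real (card (Cs b)) * real (card (Es b)) \<le> 7686 * \<delta> ^ 6 * (1 / (real_of_int b)\<^sup>2)"
      by (simp add: x_def)
  qed
  also have "\<dots> = 7686 * \<delta> ^ 6 * (\<Sum>b\<in>B. 1 / (real_of_int b)\<^sup>2)" by (simp add: sum_distrib_left)
  also have "\<dots> \<le> 7686 * \<delta> ^ 6 * 4"
    by (intro mult_left_mono sum_int_inverse_squares_le finB) (use assms in \<open>auto simp: B_def\<close>)
  finally show "real (card (reduced_zero \<delta>)) \<le> 30744 * \<delta> ^ 6" by simp
qed

section \<open>Equivalent forms near the curve\<close>

text \<open>
  Closeness to the curve in the form in which it bounds the number of points in one class: the
  leading coefficient \<open>p0 p2 - p1\<^sup>2\<close> of the Hessian is small, and \<open>p1 / p0\<close> is bounded.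
\<close>
definition near_curve :: "real \<Rightarrow> real \<Rightarrow> real \<Rightarrow> cubic set" where
  "near_curve Q K R = {(p0, p1, p2, p3). Q \<le> of_int p0 \<and> of_int p0 < 2 * Q \<and>
     \<bar>of_int (p0 * p2 - p1\<^sup>2)\<bar> \<le> K \<and> \<bar>of_int p1\<bar> \<le> R * real_of_int p0}"

lemma cramer:
  fixes v w z :: "int \<times> int"
  assumes "det2 v w = 1"
  shows "z = (det2 z w * fst v + det2 v z * fst w, det2 z w * snd v + det2 v z * snd w)"
proof -
  obtain v1 v2 w1 w2 z1 z2 where c: "v = (v1, v2)" "w = (w1, w2)" "z = (z1, z2)"
    by (cases v, cases w, cases z)
  have "v1 * w2 - v2 * w1 = 1" using assms by (simp add: c)
  then have "(z1 * w2 - z2 * w1) * v1 + (v1 * z2 - v2 * z1) * w1 = z1"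
     "(z1 * w2 - z2 * w1) * v2 + (v1 * z2 - v2 * z1) * w2 = z2" by algebra+
  then show ?thesis by (simp add: c)
qed

text \<open>
  Fix \<open>F = l\<^sup>3 + m\<^sup>3\<close> and let \<open>p\<close> be \<open>F\<close> in a basis \<open>(v, w)\<close>. With \<open>a = lin l v\<close> and
  \<open>b = lin m v\<close> we have \<open>p0 = a\<^sup>3 + b\<^sup>3\<close>, and the Hessian condition says that \<open>\<bar>a b\<bar> d\<^sup>2 \<le> K\<close>. As
  \<open>K\<^sup>3\<close> is small compared with \<open>Q\<^sup>2\<close>, one of the two cubes is of size \<open>Q\<close> and the other one is
  smaller; here it is the first one that dominates. So \<open>a\<close> is of exact order \<open>c = Q powr (1 / 3)\<close> and the
  slope \<open>b / a\<close> lies in an interval of length of the order of \<open>K / (d\<^sup>2 c\<^sup>2)\<close>. The slopes of two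
  vectors \<open>v\<close> and \<open>v'\<close> differ by \<open>d \<bar>det2 v v'\<bar> / (a a')\<close>, which is at least \<open>d / (4 c\<^sup>2)\<close> unless
  \<open>v\<close> and \<open>v'\<close> coincide. This leaves of the order of \<open>K / d\<^sup>3 + 1\<close> possible \<open>v\<close>; given \<open>v\<close>, the form
  \<open>p\<close> is determined up to translations, which shift \<open>p1 / p0\<close> by integers.
\<close>
lemma card_dominant_le:
  assumes F: "cubes F l m" and d: "1 \<le> \<bar>det2 l m\<bar>"
    and Q: "0 < Q" and K0: "0 \<le> K" and K: "16 * K ^ 3 \<le> Q\<^sup>2" and R: "0 \<le> R"
  defines "S \<equiv> {p \<in> near_curve Q K R.
      \<exists>v w. det2 v w = 1 \<and> p = subst F v w \<and> \<bar>lin m v\<bar> \<le> \<bar>lin l v\<bar>}"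
  shows "finite S \<and> real (card S) \<le> (32 * K / \<bar>det2 l m\<bar> ^ 3 + 3) * (2 * R + 3)"
proof -
  define d where "d = \<bar>det2 l m\<bar>"
  define c where "c = root 3 Q"
  have c: "0 < c" "c ^ 3 = Q" using Q by (auto simp: c_def odd_real_root_pow)
  define T where "T = 16 * K / d ^ 3"
  define \<eta> where "\<eta> = d / (4 * c\<^sup>2)"
  have d1: "1 \<le> d" using d by (simp add: d_def)
  have eta: "0 < \<eta>" using c d1 by (simp add: \<eta>_def)
  define P where "P p v w \<longleftrightarrow> det2 v w = 1 \<and> p = subst F v w \<and> c / 2 \<le> lin l v \<and> lin l v \<le> 2 * c
      \<and> \<bar>lin m v / lin l v / \<eta>\<bar> \<le> T" for p v w
  have ex: "\<exists>v w. P p v w" if "p \<in> S" for p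
  proof -
    obtain v w where p: "p \<in> near_curve Q K R" "det2 v w = 1" "p = subst F v w" "\<bar>lin m v\<bar> \<le> \<bar>lin l v\<bar>"
      using \<open>p \<in> S\<close> unfolding S_def by blast
    define a b where ab: "a = lin l v" "b = lin m v"
    obtain p0 p1 p2 p3 where pp: "p = (p0, p1, p2, p3)" by (cases p)
    have cub: "cubes p (a, lin l w) (b, lin m w)" unfolding p(3) ab by (rule cubes_subst[OF F])
    have "det2 (a, lin l w) (b, lin m w) = det2 l m" unfolding ab det2_lin p(2) by simp
    then have "real_of_int (p0 * p2 - p1\<^sup>2) = a * b * d\<^sup>2"
      using hessian_cubes[OF cub[unfolded pp]] by (simp add: d_def)
    then have "\<bar>a * b * d\<^sup>2\<bar> \<le> K" using p(1) unfolding near_curve_def pp by simp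
    then have abd: "\<bar>a * b\<bar> * d\<^sup>2 \<le> K" by (simp add: abs_mult)
    moreover have "\<bar>a * b\<bar> * 1 \<le> \<bar>a * b\<bar> * d\<^sup>2" using d1 by (intro mult_left_mono) auto
    ultimately have abK: "\<bar>a * b\<bar> \<le> K" by simp
    then have "\<bar>a * b\<bar> ^ 3 \<le> K ^ 3" by (intro power_mono) auto
    then have "\<bar>a ^ 3 * b ^ 3\<bar> \<le> Q\<^sup>2 / 16" using K by (simp add: power_mult_distrib abs_mult power_abs)
    have sum: "Q \<le> a ^ 3 + b ^ 3" "a ^ 3 + b ^ 3 < 2 * Q"
      using p(1) cub unfolding near_curve_def pp by auto
    have ba: "\<bar>b ^ 3\<bar> \<le> \<bar>a ^ 3\<bar>" using p(4) unfolding ab[symmetric] power_abs by (intro power_mono) auto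
    have a3: "Q / 2 \<le> a ^ 3" using ba sum Q by linarith
    have "Q / 2 * \<bar>b ^ 3\<bar> \<le> \<bar>a ^ 3 * b ^ 3\<bar>"
      unfolding abs_mult using a3 by (intro mult_right_mono) auto
    also have "\<dots> \<le> Q\<^sup>2 / 16" by fact
    finally have "\<bar>b ^ 3\<bar> \<le> Q / 8" using Q by (simp add: power2_eq_square field_simps)
    then have a3': "a ^ 3 \<le> 8 * Q" using sum Q by linarith
    have a0: "0 < a" using a3 Q by (metis half_gt_zero less_le_trans zero_less_power_eq odd_numeral odd_pos zero_less_power not_less power_le_zero_eq)
    have "(c / 2) ^ 3 \<le> a ^ 3" using a3 c Q by (simp add: power_divide)
    then have l: "c / 2 \<le> a" using power_mono_iff[of "c / 2" a 3] a0 c(1) by linarith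
    have "a ^ 3 \<le> (2 * c) ^ 3" using a3' c by (simp add: power_mult_distrib)
    then have u: "a \<le> 2 * c"
      using power_mono_iff[of a "2 * c" 3] a0 c(1) by linarith
    have "\<bar>b / a / \<eta>\<bar> = \<bar>a * b\<bar> * d\<^sup>2 * (4 * c\<^sup>2) / (a\<^sup>2 * d ^ 3)"
      using a0 d1 c(1) by (simp add: \<eta>_def abs_mult field_simps power2_eq_square power3_eq_cube)
    also have "\<dots> \<le> K * (4 * c\<^sup>2) / ((c / 2)\<^sup>2 * d ^ 3)"
      using abd a0 d1 c(1) l abK
      by (intro frac_le mult_mono power_mono) (auto intro: order_trans[of 0 "\<bar>a * b\<bar>"])
    also have "\<dots> = T" using c(1) d1 by (simp add: T_def field_simps power2_eq_square)
    finally have "P p v w" unfolding P_def using p l u unfolding ab by blast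
    then show ?thesis by blast
  qed
  define vw where "vw p = (SOME z. P p (fst z) (snd z))" for p
  have vw: "P p (fst (vw p)) (snd (vw p))" if "p \<in> S" for p
    unfolding vw_def using ex[OF that] by (intro someI_ex[of "\<lambda>z. P p (fst z) (snd z)"]) auto
  \<comment> \<open>The slope in units of the minimal spacing, and the translation parameter: together they
    determine p.\<close>
  define g where "g p = (\<lfloor>lin m (fst (vw p)) / lin l (fst (vw p)) / \<eta>\<rfloor>,
      \<lfloor>real_of_int (fst (snd p)) / of_int (fst p)\<rfloor>)" for p :: cubic
  define I where "I r = {x::int. \<bar>real_of_int x\<bar> \<le> r}" for r
  have fin: "finite (I r)" for r unfolding I_def by (rule finite_int_abs_le)
  have floor_I: "\<lfloor>x\<rfloor> \<in> I (r + 1)" if "\<bar>x\<bar> \<le> r" for x r :: real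
    using that unfolding I_def by (simp; linarith)
  have p0: "0 < real_of_int (fst p)" "\<bar>real_of_int (fst (snd p))\<bar> \<le> R * of_int (fst p)" if "p \<in> S" for p
  proof -
    have "p \<in> near_curve Q K R" using that unfolding S_def by blast
    then show "0 < real_of_int (fst p)" "\<bar>real_of_int (fst (snd p))\<bar> \<le> R * of_int (fst p)"
      using Q unfolding near_curve_def by auto
  qed
  have img: "g ` S \<subseteq> I (T + 1) \<times> I (R + 1)"
  proof
    fix y assume "y \<in> g ` S"
    then obtain p where p: "p \<in> S" "y = g p" by blast
    have "\<bar>real_of_int (fst (snd p)) / of_int (fst p)\<bar> \<le> R"
      using p0[OF p(1)] by (simp add: field_simps)
    then show "y \<in> I (T + 1) \<times> I (R + 1)"
      using vw[OF p(1)] unfolding p(2) g_def P_def by (auto intro!: floor_I)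
  qed
  have inj: "inj_on g S"
  proof (rule inj_onI)
    fix p q assume pq: "p \<in> S" "q \<in> S" "g p = g q"
    obtain v w where v: "vw p = (v, w)" by (cases "vw p")
    obtain v' w' where v': "vw q = (v', w')" by (cases "vw q")
    have Pp: "P p v w" and Pq: "P q v' w'" using vw[OF pq(1)] vw[OF pq(2)] by (simp_all add: v v')
    define a b a' b' where ab: "a = lin l v" "b = lin m v" "a' = lin l v'" "b' = lin m v'"
    have a: "c / 2 \<le> a" "a \<le> 2 * c" and a': "c / 2 \<le> a'" "a' \<le> 2 * c"
      using Pp Pq by (simp_all add: P_def ab)
    have pos: "0 < a" "0 < a'" using a a' c(1) by linarith+
    have det: "det2 v w = 1" "det2 v' w' = 1" using Pp Pq by (simp_all add: P_def)
    have fl: "\<lfloor>b / a / \<eta>\<rfloor> = \<lfloor>b' / a' / \<eta>\<rfloor>" using pq(3) by (simp add: g_def v v' ab)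
    then have "\<bar>b / a / \<eta> - b' / a' / \<eta>\<bar> < 1" by linarith
    moreover have "b / a / \<eta> - b' / a' / \<eta> = (b / a - b' / a') / \<eta>" by (simp only: diff_divide_distrib)
    ultimately have "\<bar>(b / a - b' / a') / \<eta>\<bar> < 1" by simp
    then have "\<bar>b / a - b' / a'\<bar> < \<eta>" using eta by (simp only: abs_divide) simp
    then have "\<bar>b / a - b' / a'\<bar> * (a * a') < \<eta> * (a * a')" using pos by simp
    also have "\<bar>b / a - b' / a'\<bar> * (a * a') = \<bar>(b / a - b' / a') * (a * a')\<bar>"
      using pos by (simp add: abs_mult)
    also have "(b / a - b' / a') * (a * a') = - det2 (a, a') (b, b')"
      using pos by (simp add: field_simps)
    also have "det2 (a, a') (b, b') = det2 l m * of_int (det2 v v')"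
      unfolding ab by (rule det2_lin)
    finally have "d * \<bar>real_of_int (det2 v v')\<bar> < \<eta> * (a * a')" by (simp add: d_def abs_mult)
    also have "\<eta> * (a * a') \<le> \<eta> * (2 * c * (2 * c))"
      using a a' pos eta c(1) by (intro mult_left_mono mult_mono) auto
    also have "\<dots> = d * 1" using c(1) by (simp add: \<eta>_def power2_eq_square)
    finally have "\<bar>real_of_int (det2 v v')\<bar> < 1" using d1 by simp
    then have z: "det2 v v' = 0" by linarith
    then have z': "det2 v' v = 0" by (cases v; cases v') (simp add: algebra_simps)
    define k k' where k: "k = det2 v' w" "k' = det2 v w'"
    have v'k: "v' = (k * fst v, k * snd v)" using cramer[OF det(1), of v'] by (simp add: z k)
    have vk: "v = (k' * fst v', k' * snd v')" using cramer[OF det(2), of v] by (simp add: z' k)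
    have "a' = of_int k * a" unfolding ab by (subst v'k) (cases l; cases v; simp add: algebra_simps)
    then have kpos: "0 < k" using pos by (simp add: zero_less_mult_iff)
    have "a = of_int k' * a'" unfolding ab by (subst vk) (cases l; cases v'; simp add: algebra_simps)
    then have k'pos: "0 < k'" using pos by (simp add: zero_less_mult_iff)
    have "a = of_int (k' * k) * a" using \<open>a = of_int k' * a'\<close> \<open>a' = of_int k * a\<close> by simp
    then have "k' * k = 1" using pos by (simp flip: of_int_mult)
    then have "k = 1" using kpos k'pos by (simp add: zmult_eq_1_iff)
    then have vv: "v' = v" using v'k by simp
    \<comment> \<open>Bases with the same first vector differ by a translation by n, which shifts p1 / p0 by n.\<close>
    define n where "n = det2 w' w"
    have w': "w' = (n * fst v + fst w, n * snd v + snd w)"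
      using cramer[OF det(1), of w'] det(2) by (simp add: vv n_def)
    have p: "p = subst F v w" and q: "q = subst F v w'" using Pp Pq vv by (simp_all add: P_def)
    have fst: "fst q = fst p" by (simp add: p q subst_def)
    have snd: "fst (snd q) = fst (snd p) + n * fst p"
      unfolding p q subst_def by (subst w') (cases F; cases v; cases w; simp add: algebra_simps)
    have "real_of_int (fst (snd q)) / of_int (fst q) = real_of_int (fst (snd p)) / of_int (fst p) + of_int n"
      using p0[OF pq(1)] unfolding snd fst by (simp add: field_simps)
    then have "n = 0" using pq(3) by (simp add: g_def)
    then show "p = q" using w' by (simp add: p q)
  qed
  have finI: "finite (I (T + 1) \<times> I (R + 1))" using fin by blast
  have finS: "finite S" by (rule inj_on_finite[OF inj img finI])
  have T: "0 \<le> T" using K0 d1 by (simp add: T_def)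
  have "card S \<le> card (I (T + 1) \<times> I (R + 1))" by (rule card_inj_on_le[OF inj img finI])
  then have "real (card S) \<le> real (card (I (T + 1))) * real (card (I (R + 1)))"
    by (simp add: card_cartesian_product flip: of_nat_mult)
  also have "\<dots> \<le> (2 * (T + 1) + 1) * (2 * (R + 1) + 1)"
    unfolding I_def by (intro mult_mono card_int_abs_le) (use T R in auto)
  also have "\<dots> = (32 * K / d ^ 3 + 3) * (2 * R + 3)" by (simp add: T_def algebra_simps)
  finally show ?thesis using finS by (simp add: d_def)
qed

text \<open>
  Either of the two cubes may dominate, and the previous lemma applies to both cases by symmetry.
\<close>
lemma card_orbit_le:
  assumes F: "cubes F l m" and d: "1 \<le> \<bar>det2 l m\<bar>"
    and QKR: "0 < Q" "0 \<le> K" "16 * K ^ 3 \<le> Q\<^sup>2" "0 \<le> R"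
  shows "finite {p \<in> near_curve Q K R. equiv_cubic F p} \<and>
    real (card {p \<in> near_curve Q K R. equiv_cubic F p})
      \<le> 2 * ((32 * K / \<bar>det2 l m\<bar> ^ 3 + 3) * (2 * R + 3))"
proof -
  define S where "S l m = {p \<in> near_curve Q K R.
      \<exists>v w. det2 v w = 1 \<and> p = subst F v w \<and> \<bar>lin m v\<bar> \<le> \<bar>lin l v\<bar>}" for l m
  have sym: "\<bar>det2 m l\<bar> = \<bar>det2 l m\<bar>" by (cases l; cases m) (simp add: abs_minus_commute mult.commute)
  have F': "cubes F m l" using F by (cases F; cases l; cases m) (simp add: add.commute)
  have 1: "finite (S l m) \<and> real (card (S l m)) \<le> (32 * K / \<bar>det2 l m\<bar> ^ 3 + 3) * (2 * R + 3)"
    unfolding S_def by (rule card_dominant_le[OF F d QKR])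
  have 2: "finite (S m l) \<and> real (card (S m l)) \<le> (32 * K / \<bar>det2 l m\<bar> ^ 3 + 3) * (2 * R + 3)"
    unfolding S_def using card_dominant_le[OF F' _ QKR] d unfolding sym by blast
  have "{p \<in> near_curve Q K R. equiv_cubic F p} \<subseteq> S l m \<union> S m l"
    unfolding S_def equiv_cubic_def using linear by blast
  moreover have fin: "finite (S l m \<union> S m l)" using 1 2 by blast
  ultimately have "finite {p \<in> near_curve Q K R. equiv_cubic F p}"
     "card {p \<in> near_curve Q K R. equiv_cubic F p} \<le> card (S l m \<union> S m l)"
    by (auto intro: finite_subset card_mono)
  then show ?thesis using 1 2 card_Un_le[of "S l m" "S m l"] by linarith
qed

section \<open>The number of integral forms near the curve\<close>

text \<open>
  Every class of forms with discriminant between \<open>2 ^ i\<close> and \<open>2 ^ (i + 1)\<close> has a member here.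
\<close>
definition reduced_cubics :: "nat \<Rightarrow> cubic set" where
  "reduced_cubics i = {F \<in> reduced_nonzero (root 6 (2 ^ Suc i)) \<union> reduced_zero (root 6 (2 ^ Suc i)).
     \<exists>l m. cubes F l m \<and> 0 < det2 l m \<and> 2 ^ i \<le> (det2 l m) ^ 6}"

lemma card_reduced_cubics_le:
  "finite (reduced_cubics i) \<and> real (card (reduced_cubics i)) \<le> 11000000 * (real i + 4) * 2 ^ i"
proof -
  define \<delta> :: real where "\<delta> = root 6 (2 ^ Suc i)"
  have d6: "\<delta> ^ 6 = 2 ^ Suc i" unfolding \<delta>_def by (subst real_root_pow_pos2) auto
  have "(1::real) \<le> 2 ^ Suc i" by (rule one_le_power) simp
  then have d1: "1 \<le> \<delta>" unfolding \<delta>_def by (simp del: power_Suc)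
  have "\<delta> \<le> \<delta> ^ 6" using power_increasing[of 1 6 \<delta>] d1 by simp
  then have J: "4 * \<delta> \<le> 2 ^ (i + 3)" unfolding d6 by (simp add: power_add)
  note nz = card_reduced_nonzero[OF d1 J] and z = card_reduced_zero[OF d1]
  have sub: "reduced_cubics i \<subseteq> reduced_nonzero \<delta> \<union> reduced_zero \<delta>"
    unfolding reduced_cubics_def \<delta>_def by blast
  have fin: "finite (reduced_nonzero \<delta> \<union> reduced_zero \<delta>)" using nz z by blast
  have "card (reduced_cubics i) \<le> card (reduced_nonzero \<delta>) + card (reduced_zero \<delta>)"
    using card_mono[OF fin sub] card_Un_le[of "reduced_nonzero \<delta>" "reduced_zero \<delta>"] by linarith
  then have "real (card (reduced_cubics i)) \<le> (real (i + 3) + 1) * 5308416 * \<delta> ^ 6 + 30744 * \<delta> ^ 6"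
    using nz(2) z(2) by linarith
  also have "\<dots> = (10616832 * (real i + 4) + 61488) * 2 ^ i" unfolding d6 by (simp add: algebra_simps)
  also have "\<dots> \<le> (11000000 * (real i + 4)) * 2 ^ i" by (intro mult_right_mono) auto
  finally show ?thesis using finite_subset[OF sub fin] by blast
qed

text \<open>
  There are at most of the order of \<open>i 2 ^ i\<close> classes with discriminant about \<open>2 ^ i\<close>, and each
  of them contains at most of the order of \<open>K / 2 powr (i / 2) + 1\<close> forms near the curve. The product is
  largest for the largest discriminants, where \<open>2 ^ i\<close> is about \<open>K\<^sup>2\<close>; the sum over \<open>i\<close> costs
  another factor \<open>n\<close>.
\<close>
lemma card_near_curve_le:
  assumes Q: "0 < Q" and K: "1 \<le> K" "16 * K ^ 3 \<le> Q\<^sup>2" and R: "0 \<le> R"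
    and n: "K\<^sup>2 \<le> 2 ^ n" "2 ^ n \<le> 2 * K\<^sup>2"
  defines "W \<equiv> {p \<in> near_curve Q K R. 0 < disc p \<and> of_int (disc p) \<le> K\<^sup>2}"
  shows "finite W \<and> real (card W) \<le> 1200000000 * (real n + 4)\<^sup>2 * (2 * R + 3) * K\<^sup>2"
proof -
  define Orb where "Orb F = {p \<in> near_curve Q K R. equiv_cubic F p}" for F
  have orb: "finite (Orb F)" "real (card (Orb F)) \<le> 2 * ((32 * K / sqrt (2 ^ i) + 3) * (2 * R + 3))"
    if F: "F \<in> reduced_cubics i" for F i
  proof -
    obtain l m where lm: "cubes F l m" "0 < det2 l m" "2 ^ i \<le> (det2 l m) ^ 6"
      using F unfolding reduced_cubics_def by blast
    have "1 \<le> (det2 l m) ^ 6" using lm(3) one_le_power[of "2::real" i] by linarith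
    then have d: "1 \<le> \<bar>det2 l m\<bar>" using lm(2) power_mono_iff[of 1 "det2 l m" 6] by simp
    have "2 ^ i \<le> (det2 l m ^ 3)\<^sup>2" using lm(3) by (simp flip: power_mult)
    then have s: "sqrt (2 ^ i) \<le> det2 l m ^ 3" using lm(2) by (simp add: real_le_lsqrt real_sqrt_le_iff)
    have "32 * K / \<bar>det2 l m\<bar> ^ 3 \<le> 32 * K / sqrt (2 ^ i)"
      using s lm(2) K by (intro divide_left_mono) auto
    then have "(32 * K / \<bar>det2 l m\<bar> ^ 3 + 3) * (2 * R + 3) \<le> (32 * K / sqrt (2 ^ i) + 3) * (2 * R + 3)"
      using R by (intro mult_right_mono) auto
    then show "finite (Orb F)" "real (card (Orb F)) \<le> 2 * ((32 * K / sqrt (2 ^ i) + 3) * (2 * R + 3))"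
      using card_orbit_le[OF lm(1) d Q _ K(2) R] K(1) unfolding Orb_def by (auto intro: order_trans)
  qed
  have sub: "W \<subseteq> (\<Union>i\<in>{..n}. \<Union>F\<in>reduced_cubics i. Orb F)"
  proof
    fix p assume p: "p \<in> W"
    obtain p0 p1 p2 p3 where pp: "p = (p0, p1, p2, p3)" by (cases p)
    have "p0 \<noteq> 0" using p Q unfolding W_def near_curve_def pp by auto
    moreover have D: "0 < disc p" using p by (simp add: W_def)
    ultimately obtain l m where lm: "cubes p l m" "0 < det2 l m" using ex_cubes unfolding pp by blast
    have "1 \<le> nat (disc p)" using D by linarith
    then obtain i where i: "2 ^ i \<le> nat (disc p)" "nat (disc p) < 2 ^ (i + 1)"
      using ex_power_ivl1[of 2 "nat (disc p)"] by blast
    have "real (2 ^ i) \<le> real (nat (disc p))" "real (nat (disc p)) \<le> real (2 ^ (i + 1))"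
      using i by (auto simp only: of_nat_le_iff)
    then have "2 ^ i \<le> real_of_int (disc p)" "real_of_int (disc p) \<le> 2 ^ Suc i" using D by simp_all
    then have di: "2 ^ i \<le> (det2 l m) ^ 6" "(det2 l m) ^ 6 \<le> 2 ^ Suc i"
      unfolding disc_cubes[OF lm(1)] .
    have "det2 l m = root 6 ((det2 l m) ^ 6)" using lm(2) by (simp add: real_root_power_cancel)
    also have "\<dots> \<le> root 6 (2 ^ Suc i)" using di(2) by (subst real_root_le_iff) auto
    finally obtain F l' m' where F: "F \<in> reduced_nonzero (root 6 (2 ^ Suc i)) \<union> reduced_zero (root 6 (2 ^ Suc i))"
      "equiv_cubic F p" "cubes F l' m'" "det2 l' m' = det2 l m"
      using ex_reduced_equiv[OF lm] by blast
    have "0 < det2 l' m'" "2 ^ i \<le> (det2 l' m') ^ 6" using F(4) di lm(2) by simp_all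
    then have "F \<in> reduced_cubics i" unfolding reduced_cubics_def using F(1,3) by blast
    moreover have "p \<in> Orb F" using p F by (simp add: Orb_def W_def)
    moreover have "real_of_int (disc p) \<le> K\<^sup>2" using p by (simp add: W_def)
    then have "(2::real) ^ i \<le> 2 ^ n" using n(1) \<open>2 ^ i \<le> real_of_int (disc p)\<close> by linarith
    then have "i \<le> n" by simp
    ultimately show "p \<in> (\<Union>i\<in>{..n}. \<Union>F\<in>reduced_cubics i. Orb F)" by blast
  qed
  have fin: "finite (\<Union>i\<in>{..n}. \<Union>F\<in>reduced_cubics i. Orb F)"
    using card_reduced_cubics_le orb(1) by blast
  have "card W \<le> card (\<Union>i\<in>{..n}. \<Union>F\<in>reduced_cubics i. Orb F)" by (rule card_mono[OF fin sub])
  also have "\<dots> \<le> (\<Sum>i\<in>{..n}. card (\<Union>F\<in>reduced_cubics i. Orb F))" by (rule card_UN_le) simp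
  also have "\<dots> \<le> (\<Sum>i\<in>{..n}. \<Sum>F\<in>reduced_cubics i. card (Orb F))"
    by (intro sum_mono card_UN_le) (use card_reduced_cubics_le in blast)
  finally have "real (card W) \<le> (\<Sum>i\<in>{..n}. \<Sum>F\<in>reduced_cubics i. real (card (Orb F)))"
    by (simp flip: of_nat_sum)
  also have "\<dots> \<le> (\<Sum>i\<in>{..n}. 11000000 * (real n + 4) * (104 * (2 * R + 3) * K\<^sup>2))"
  proof (rule sum_mono)
    fix i assume i: "i \<in> {..n}"
    have "(\<Sum>F\<in>reduced_cubics i. real (card (Orb F)))
        \<le> real (card (reduced_cubics i)) * (2 * ((32 * K / sqrt (2 ^ i) + 3) * (2 * R + 3)))"
      using sum_bounded_above[of "reduced_cubics i" "\<lambda>F. real (card (Orb F))"] orb(2) by simp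
    also have "\<dots> \<le> 11000000 * (real i + 4) * 2 ^ i * (2 * ((32 * K / sqrt (2 ^ i) + 3) * (2 * R + 3)))"
      using card_reduced_cubics_le[of i] K R by (intro mult_right_mono) auto
    also have "\<dots> = 11000000 * (real i + 4) * (2 * ((32 * K * (2 ^ i / sqrt (2 ^ i)) + 3 * 2 ^ i) * (2 * R + 3)))"
      by (simp add: algebra_simps)
    also have "(2::real) ^ i / sqrt (2 ^ i) = sqrt (2 ^ i)" by (rule real_div_sqrt) simp
    also have "11000000 * (real i + 4) * (2 * ((32 * K * sqrt (2 ^ i) + 3 * 2 ^ i) * (2 * R + 3)))
       \<le> 11000000 * (real n + 4) * (2 * ((52 * K\<^sup>2) * (2 * R + 3)))"
    proof -
      have "(2::real) ^ i \<le> 2 ^ n" using i by simp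
      then have 2: "(2::real) ^ i \<le> 2 * K\<^sup>2" using n(2) by linarith
      have "sqrt (2 ^ i) \<le> sqrt (2 * K\<^sup>2)" using 2 by simp
      also have "\<dots> = sqrt 2 * K" using K by (simp add: real_sqrt_mult)
      \<comment> \<open>1.4375 exceeds sqrt 2, and 32 * 1.4375 + 3 * 2 = 52\<close>
      also have "\<dots> \<le> 1.4375 * K" using K by (intro mult_right_mono real_le_lsqrt) (auto simp: power2_eq_square)
      finally have "K * sqrt (2 ^ i) \<le> K * (1.4375 * K)" using K by (intro mult_left_mono) auto
      then have "32 * K * sqrt (2 ^ i) + 3 * 2 ^ i \<le> 52 * K\<^sup>2" using 2 by (simp add: power2_eq_square)
      then show ?thesis using i K R by (intro mult_mono) auto
    qed
    finally show "(\<Sum>F\<in>reduced_cubics i. real (card (Orb F)))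
        \<le> 11000000 * (real n + 4) * (104 * (2 * R + 3) * K\<^sup>2)" by (simp add: algebra_simps)
  qed
  also have "\<dots> = (1144000000 * (2 * R + 3) * K\<^sup>2) * ((real n + 1) * (real n + 4))" by (simp add: algebra_simps)
  also have "\<dots> \<le> (1200000000 * (2 * R + 3) * K\<^sup>2) * ((real n + 4) * (real n + 4))"
    using K R by (intro mult_mono) auto
  finally show ?thesis using finite_subset[OF sub fin] by (simp add: power2_eq_square algebra_simps)
qed

section \<open>Generic approximations\<close>

text \<open>
  The discriminant is invariant under the translation by \<open>x\<close>, which replaces \<open>p1, p2, p3\<close> by
  numbers \<open>q1, q2, q3\<close> of size at most \<open>\<eta>\<close>. In terms of these it is \<open>(p0 q3)\<^sup>2\<close> up to an error of
  order \<open>Q \<eta>\<^sup>3\<close>. When that error is below \<open>1\<close>, the discriminant exceeds \<open>- 1\<close>; being a nonzero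
  integer for a generic point, it is positive. This step is where the exponent \<open>1 / 3\<close> enters:
  \<open>\<eta>\<close> has the order of \<open>Q powr (- lam)\<close>, and \<open>Q \<eta>\<^sup>3\<close> tends to zero exactly if \<open>lam > 1 / 3\<close>.
\<close>
lemma generic_in_near_curve:
  assumes gen: "generic (p0, p1, p2, p3)" and p0: "1 \<le> Q" "Q \<le> of_int p0" "of_int p0 < 2 * Q"
    and x: "\<bar>x\<bar> \<le> R" "1 \<le> R"
    and e: "\<bar>of_int p0 * x - of_int p1\<bar> \<le> \<epsilon>" "\<bar>of_int p0 * x ^ 2 - of_int p2\<bar> \<le> \<epsilon>"
       "\<bar>of_int p0 * x ^ 3 - of_int p3\<bar> \<le> \<epsilon>"
    and \<eta>: "7 * R\<^sup>2 * \<epsilon> \<le> \<eta>" "\<eta> \<le> 1" "20 * Q * \<eta> ^ 3 + 7 * \<eta> ^ 4 < 1"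
  shows "(p0, p1, p2, p3) \<in> near_curve Q (2 * Q * \<eta> + 1) (R + 1)"
    "0 < disc (p0, p1, p2, p3)" "of_int (disc (p0, p1, p2, p3)) \<le> (2 * Q * \<eta> + 1)\<^sup>2"
proof -
  define r0 r1 r2 r3 where r: "r0 = real_of_int p0" "r1 = real_of_int p1"
    "r2 = real_of_int p2" "r3 = real_of_int p3"
  define q1 q2 q3 where q: "q1 = r1 - x * r0" "q2 = r2 - 2 * x * r1 + x\<^sup>2 * r0"
    "q3 = r3 - 3 * x * r2 + 3 * x\<^sup>2 * r1 - x ^ 3 * r0"
  have e1: "\<bar>r1 - x * r0\<bar> \<le> \<epsilon>" and e2: "\<bar>r2 - x\<^sup>2 * r0\<bar> \<le> \<epsilon>" and e3: "\<bar>r3 - x ^ 3 * r0\<bar> \<le> \<epsilon>"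
    using e unfolding r by (simp_all add: abs_minus_commute mult.commute)
  have e0: "0 \<le> \<epsilon>" using e1 by linarith
  have R2: "R \<le> R\<^sup>2" "1 \<le> R\<^sup>2" using x(2) power_increasing[of 1 2 R] by (simp_all add: one_le_power)
  have xx: "x\<^sup>2 \<le> R\<^sup>2" using x by (simp add: abs_le_square_iff[symmetric])
  have xe: "\<bar>x\<bar> * \<bar>y\<bar> \<le> R\<^sup>2 * \<epsilon>" if "\<bar>y\<bar> \<le> \<epsilon>" for y
    using that x R2 by (intro mult_mono) auto
  have xxe: "x\<^sup>2 * \<bar>y\<bar> \<le> R\<^sup>2 * \<epsilon>" if "\<bar>y\<bar> \<le> \<epsilon>" for y
    using that xx by (intro mult_mono) auto
  have eR: "\<epsilon> \<le> R\<^sup>2 * \<epsilon>" using R2 e0 mult_right_mono[of 1 "R\<^sup>2" \<epsilon>] by simp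
  \<comment> \<open>q1, q2, q3 are at most 1, 1 + 2 R^2 and 1 + 6 R^2 times the error; as R is at least 1, the factor 7 R^2 covers all three.\<close>
  have q1: "\<bar>q1\<bar> \<le> \<eta>" using e1 eR \<eta>(1) e0 unfolding q by linarith
  have "q2 = (r2 - x\<^sup>2 * r0) - 2 * (x * (r1 - x * r0))" unfolding q by algebra
  also have "\<bar>\<dots>\<bar> \<le> \<bar>r2 - x\<^sup>2 * r0\<bar> + 2 * (\<bar>x\<bar> * \<bar>r1 - x * r0\<bar>)"
    unfolding abs_mult[symmetric] by linarith
  also have "\<dots> \<le> \<eta>" using xe[OF e1] e2 eR \<eta>(1) e0 by linarith
  finally have q2: "\<bar>q2\<bar> \<le> \<eta>" .
  have "q3 = (r3 - x ^ 3 * r0) - 3 * (x * (r2 - x\<^sup>2 * r0)) + 3 * (x\<^sup>2 * (r1 - x * r0))"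
    unfolding q by algebra
  also have "\<bar>\<dots>\<bar> \<le> \<bar>r3 - x ^ 3 * r0\<bar> + 3 * (\<bar>x\<bar> * \<bar>r2 - x\<^sup>2 * r0\<bar>) + 3 * (\<bar>x\<^sup>2\<bar> * \<bar>r1 - x * r0\<bar>)"
    unfolding abs_mult[symmetric] by linarith
  also have "\<dots> \<le> \<eta>" using xe[OF e2] xxe[OF e1] e3 eR \<eta>(1) e0 by simp
  finally have q3: "\<bar>q3\<bar> \<le> \<eta>" .
  have \<eta>0: "0 \<le> \<eta>" using q1 by linarith
  have r0: "Q \<le> r0" "r0 < 2 * Q" "0 < r0" using p0 by (simp_all add: r)
  define C where "C = r0 * r2 - r1\<^sup>2"
  have "C = r0 * q2 - q1\<^sup>2" unfolding C_def q by algebra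
  moreover have "\<bar>r0 * q2\<bar> \<le> 2 * Q * \<eta>" unfolding abs_mult using r0 q2 by (intro mult_mono) auto
  moreover have q1s: "q1\<^sup>2 \<le> 1"
  proof -
    have "q1\<^sup>2 \<le> \<eta>\<^sup>2" using q1 \<eta>0 by (simp add: abs_le_square_iff[symmetric])
    also have "\<dots> \<le> 1" using \<eta>0 \<eta>(2) by (simp add: power_le_one)
    finally show ?thesis .
  qed
  ultimately have C: "\<bar>C\<bar> \<le> 2 * Q * \<eta> + 1" using zero_le_power2[of q1] by linarith
  have "\<epsilon> \<le> 1" using eR \<eta>(1,2) e0 by linarith
  have "\<bar>r1\<bar> \<le> \<bar>x\<bar> * r0 + 1"
    using e1 \<open>\<epsilon> \<le> 1\<close> abs_mult[of x r0] r0 by linarith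
  also have "\<dots> \<le> R * r0 + r0" using x r0 p0(1) by (intro add_mono mult_right_mono) auto
  finally have "\<bar>r1\<bar> \<le> (R + 1) * r0" by (simp add: algebra_simps)
  then show "(p0, p1, p2, p3) \<in> near_curve Q (2 * Q * \<eta> + 1) (R + 1)"
    using C r0 unfolding near_curve_def C_def r by simp
  define D where "D = real_of_int (disc (p0, p1, p2, p3))"
  have "D = (r0 * r3 - r1 * r2)\<^sup>2 - 4 * (r0 * r2 - r1\<^sup>2) * (r1 * r3 - r2\<^sup>2)" by (simp add: D_def r)
  also have "\<dots> = (r0 * q3)\<^sup>2 - 6 * (r0 * (q1 * q2 * q3)) - 3 * (q1\<^sup>2 * q2\<^sup>2) + 4 * (r0 * q2 ^ 3) + 4 * (q1 ^ 3 * q3)"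
    unfolding q by algebra
  finally have D: "D = \<dots>" .
  have b: "\<bar>r0 * (q1 * q2 * q3)\<bar> \<le> 2 * Q * (\<eta> * \<eta> * \<eta>)" "\<bar>r0 * q2 ^ 3\<bar> \<le> 2 * Q * \<eta> ^ 3"
     "\<bar>q1\<^sup>2 * q2\<^sup>2\<bar> \<le> \<eta>\<^sup>2 * \<eta>\<^sup>2" "\<bar>q1 ^ 3 * q3\<bar> \<le> \<eta> ^ 3 * \<eta>" "\<bar>r0 * q3\<bar> \<le> 2 * Q * \<eta>"
    unfolding abs_mult power_abs using r0 q1 q2 q3 \<eta>0 by (intro mult_mono power_mono; simp)+
  have "2 * Q * (\<eta> * \<eta> * \<eta>) = 2 * Q * \<eta> ^ 3" "\<eta>\<^sup>2 * \<eta>\<^sup>2 = \<eta> ^ 4" "\<eta> ^ 3 * \<eta> = \<eta> ^ 4" by algebra+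
  then have dev: "\<bar>D - (r0 * q3)\<^sup>2\<bar> < 1" using b(1-4) \<eta>(3) unfolding D by linarith
  have "disc (p0, p1, p2, p3) \<noteq> 0"
    using gen special_if_disc_eq_0 r0 unfolding generic_def r by force
  moreover have "D > - 1" using dev zero_le_power2[of "r0 * q3"] by linarith
  ultimately show "0 < disc (p0, p1, p2, p3)" unfolding D_def by linarith
  have "(r0 * q3)\<^sup>2 \<le> (2 * Q * \<eta>)\<^sup>2" using b(5) by (metis abs_ge_zero power2_abs power_mono)
  then have "D \<le> (2 * Q * \<eta>)\<^sup>2 + 1" using dev by linarith
  also have "\<dots> \<le> (2 * Q * \<eta> + 1)\<^sup>2" using \<eta>0 p0(1) by (simp add: power2_eq_square algebra_simps)
  finally show "of_int (disc (p0, p1, p2, p3)) \<le> (2 * Q * \<eta> + 1)\<^sup>2" unfolding D_def .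
qed

definition approximants :: "real \<Rightarrow> real \<Rightarrow> cubic set" where
  "approximants x lam = {(p0, p1, p2, p3). 0 < p0 \<and> generic (p0, p1, p2, p3) \<and>
     Max {\<bar>of_int p0 * x - of_int p1\<bar>, \<bar>of_int p0 * x ^ 2 - of_int p2\<bar>,
          \<bar>of_int p0 * x ^ 3 - of_int p3\<bar>} < of_int p0 powr (- lam)}"

lemma S_g_eq: "S_g I lam = {x \<in> I. infinite (approximants x lam)}"
  by (simp add: S_g_def approximants_def)

text \<open>
  A point with infinitely many generic approximations has some with arbitrarily large first
  coordinate, because the other coordinates are determined up to a bounded error.
\<close>
lemma finite_approximants_below:
  assumes "0 \<le> lam"
  shows "finite {p \<in> approximants x lam. fst p < N}"
proof -
  define I where "I r = {z::int. \<bar>real_of_int z\<bar> \<le> r}" for r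
  have sub: "{p \<in> approximants x lam. fst p < N}
      \<subseteq> {0..N} \<times> I (of_int N * \<bar>x\<bar> + 1) \<times> I (of_int N * \<bar>x ^ 2\<bar> + 1) \<times> I (of_int N * \<bar>x ^ 3\<bar> + 1)"
  proof
    fix p assume p: "p \<in> {p \<in> approximants x lam. fst p < N}"
    obtain p0 p1 p2 p3 where pp: "p = (p0, p1, p2, p3)" by (cases p)
    have p0: "0 < p0" "p0 < N" using p by (auto simp: pp approximants_def)
    have "of_int p0 powr (- lam) \<le> 1" using p0 assms powr_mono[of "- lam" 0 "real_of_int p0"] by simp
    then have e: "\<bar>of_int p0 * x - of_int p1\<bar> < 1" "\<bar>of_int p0 * x ^ 2 - of_int p2\<bar> < 1"
      "\<bar>of_int p0 * x ^ 3 - of_int p3\<bar> < 1" using p by (auto simp: pp approximants_def)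
    have in_I: "z \<in> I (of_int N * \<bar>y\<bar> + 1)" if "\<bar>of_int p0 * y - of_int z\<bar> < 1" for y z
    proof -
      have "\<bar>of_int p0 * y\<bar> \<le> of_int N * \<bar>y\<bar>" unfolding abs_mult using p0 by (intro mult_right_mono) auto
      then show ?thesis using that unfolding I_def by simp
    qed
    show "p \<in> {0..N} \<times> I (of_int N * \<bar>x\<bar> + 1) \<times> I (of_int N * \<bar>x ^ 2\<bar> + 1) \<times> I (of_int N * \<bar>x ^ 3\<bar> + 1)"
      using p0 in_I[OF e(1)] in_I[OF e(2)] in_I[OF e(3)] by (simp add: pp)
  qed
  have fin: "finite (I r)" for r unfolding I_def by (rule finite_int_abs_le)
  show ?thesis by (rule finite_subset[OF sub]) (intro finite_cartesian_product fin finite_atLeastAtMost_int)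
qed

text \<open>
  With \<open>\<theta> = \<rho>\<^sup>3\<close> the series is dominated by that of \<open>\<rho> ^ k\<close>, as \<open>k \<rho> ^ k\<close> is bounded.
\<close>
lemma summable_poly_times_geometric:
  fixes \<theta> :: real
  assumes "0 < \<theta>" "\<theta> < 1"
  shows "summable (\<lambda>k. (2 * real k + 5)\<^sup>2 * \<theta> ^ k)"
proof -
  define \<rho> where "\<rho> = root 3 \<theta>"
  have \<rho>: "0 < \<rho>" "\<rho> < 1" "\<rho> ^ 3 = \<theta>" using assms by (simp_all add: \<rho>_def)
  have "(\<lambda>k. 2 * (real k * \<rho> ^ k) + 5 * \<rho> ^ k) \<longlonglongrightarrow> 2 * 0 + 5 * 0"
    by (intro tendsto_intros powser_times_n_limit_0 LIMSEQ_power_zero) (use \<rho> in auto)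
  then have "Bseq (\<lambda>k. 2 * (real k * \<rho> ^ k) + 5 * \<rho> ^ k)"
    by (intro convergent_imp_Bseq) (auto simp: convergent_def)
  then obtain M where M: "\<And>k. norm (2 * (real k * \<rho> ^ k) + 5 * \<rho> ^ k) \<le> M"
    unfolding Bseq_def by blast
  have "summable (\<lambda>k. M\<^sup>2 * \<rho> ^ k)" using \<rho> by (intro summable_mult summable_geometric) auto
  then show ?thesis
  proof (rule summable_comparison_test')
    fix k :: nat
    have \<theta>: "\<theta> ^ k = \<rho> ^ k * \<rho> ^ k * \<rho> ^ k"
      unfolding \<rho>(3)[symmetric] by (simp add: power3_eq_cube power_mult_distrib)
    have "(2 * real k + 5)\<^sup>2 * \<theta> ^ k = (2 * (real k * \<rho> ^ k) + 5 * \<rho> ^ k)\<^sup>2 * \<rho> ^ k"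
      unfolding \<theta> by algebra
    also have "\<dots> \<le> M\<^sup>2 * \<rho> ^ k"
      using M[of k] \<rho>(1) by (intro mult_right_mono) (auto simp: abs_le_square_iff[symmetric])
    finally show "norm ((2 * real k + 5)\<^sup>2 * \<theta> ^ k) \<le> M\<^sup>2 * \<rho> ^ k" using assms by simp
  qed
qed

section \<open>The dimension bound\<close>

text \<open>
  The points with \<open>2 ^ k \<le> p0 < 2 ^ (k + 1)\<close> form the \<open>k\<close>-th generation. With
  \<open>K\<close> of the order of \<open>2 powr ((1 - lam) * k)\<close>, there are at most of the order of
  \<open>k\<^sup>2 K\<^sup>2\<close> of them, and each accounts for real numbers \<open>x\<close> in an interval of length at most
  \<open>2 * 2 powr (- (1 + lam) * k)\<close>. The sum of the \<open>s\<close>-th powers of these lengths converges as soon as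
  \<open>(1 + lam) s > 2 - 2 lam\<close>. For small \<open>k\<close> the estimates do not hold yet, and those generations
  are left empty.
\<close>
lemma hausdorff_measure_S_g_bounded:
  assumes lam: "1 / 3 < lam" "lam \<le> 1" and s: "0 < s" "2 - 2 * lam < (1 + lam) * s" and R: "1 \<le> R"
  shows "hausdorff_measure s (S_g {-R..R} lam) = 0"
proof -
  define c where "c = 7 * R\<^sup>2"
  define \<eta> where "\<eta> k = c * 2 powr (- lam * real k)" for k :: nat
  define K where "K k = 2 * 2 ^ k * \<eta> k + 1" for k :: nat
  have c: "7 \<le> c" using R by (simp add: c_def)
  have pw: "2 powr (a * real k) = (2 powr a) ^ k" for a k
    by (simp add: powr_powr[symmetric] powr_realpow)
  have pp: "(2 powr a) ^ n = 2 powr (real n * a)" for a :: real and n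
    by (simp add: powr_realpow[symmetric] powr_powr mult.commute)
  have lim: "(\<lambda>k. (2 powr a) ^ k) \<longlonglongrightarrow> 0" if "a < 0" for a :: real
    using that by (intro LIMSEQ_power_zero) (simp add: powr_less_one)
  have \<eta>0: "0 < \<eta> k" for k using c by (simp add: \<eta>_def)
  have K1: "1 \<le> K k" for k using \<eta>0[of k] by (simp add: K_def)
  have "\<eta> \<longlonglongrightarrow> c * 0"
    unfolding \<eta>_def[abs_def] pw by (intro tendsto_intros lim) (use lam in simp)
  then have \<eta>_lim: "\<eta> \<longlonglongrightarrow> 0" by simp
  \<comment> \<open>The error in the discriminant tends to zero, because 1 - 3 lam is negative.\<close>
  have Q\<eta>: "2 ^ k * \<eta> k ^ 3 = c ^ 3 * (2 powr (1 - 3 * lam)) ^ k" for k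
  proof -
    have "2 ^ k * \<eta> k ^ 3 = c ^ 3 * (2 powr (1 * real k) * (2 powr (- lam * real k)) ^ 3)"
      by (simp add: \<eta>_def power_mult_distrib powr_realpow)
    also have "(2 powr (- lam * real k)) ^ 3 = 2 powr (- 3 * lam * real k)"
      unfolding pp by (simp add: mult_ac)
    finally show ?thesis unfolding pw[symmetric] by (simp add: powr_add[symmetric] algebra_simps)
  qed
  have "(\<lambda>k. 20 * (c ^ 3 * (2 powr (1 - 3 * lam)) ^ k) + 7 * \<eta> k ^ 4) \<longlonglongrightarrow> 20 * (c ^ 3 * 0) + 7 * 0 ^ 4"
    by (intro tendsto_intros lim \<eta>_lim) (use lam in simp)
  then have lim2: "(\<lambda>k. 20 * 2 ^ k * \<eta> k ^ 3 + 7 * \<eta> k ^ 4) \<longlonglongrightarrow> 0"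
    by (simp add: mult.assoc Q\<eta>)
  have K_le: "K k \<le> (2 * c + 1) * 2 powr ((1 - lam) * real k)" for k
  proof -
    have "2 ^ k * \<eta> k = c * (2 powr (1 * real k) * 2 powr (- lam * real k))"
      by (simp add: \<eta>_def powr_realpow)
    also have "\<dots> = c * 2 powr ((1 - lam) * real k)" by (simp add: powr_add[symmetric] algebra_simps)
    finally have "K k = 2 * c * 2 powr ((1 - lam) * real k) + 1" by (simp add: K_def)
    moreover have "1 \<le> 2 powr ((1 - lam) * real k)" using lam by (intro ge_one_powr_ge_zero) auto
    ultimately show ?thesis by (simp add: algebra_simps)
  qed
  \<comment> \<open>The same exponent decides that K ^ 3 becomes small compared with Q ^ 2, since
    3 (1 - lam) - 2 = 1 - 3 lam.\<close>
  have K3: "16 * K k ^ 3 \<le> 16 * (2 * c + 1) ^ 3 * (2 powr (1 - 3 * lam)) ^ k * (2 ^ k)\<^sup>2" for k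
  proof -
    have "K k ^ 3 \<le> ((2 * c + 1) * 2 powr ((1 - lam) * real k)) ^ 3"
      using K_le K1[of k] by (intro power_mono) auto
    also have "\<dots> = (2 * c + 1) ^ 3 * 2 powr ((3 - 3 * lam) * real k)"
      unfolding power_mult_distrib pp by (simp add: algebra_simps)
    also have "2 powr ((3 - 3 * lam) * real k) = 2 powr ((1 - 3 * lam) * real k) * (2 powr (1 * real k) * 2 powr (1 * real k))"
      by (simp add: powr_add[symmetric] algebra_simps)
    also have "\<dots> = (2 powr (1 - 3 * lam)) ^ k * (2 ^ k)\<^sup>2"
      unfolding pw by (simp add: power2_eq_square)
    finally show ?thesis by simp
  qed
  have "(\<lambda>k. 16 * (2 * c + 1) ^ 3 * (2 powr (1 - 3 * lam)) ^ k) \<longlonglongrightarrow> 16 * (2 * c + 1) ^ 3 * 0"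
    by (intro tendsto_intros lim) (use lam in simp)
  then have lim3: "(\<lambda>k. 16 * (2 * c + 1) ^ 3 * (2 powr (1 - 3 * lam)) ^ k) \<longlonglongrightarrow> 0" by simp
  have "\<forall>\<^sub>F k in sequentially. \<eta> k < 1 \<and> 20 * 2 ^ k * \<eta> k ^ 3 + 7 * \<eta> k ^ 4 < 1 \<and>
      16 * (2 * c + 1) ^ 3 * (2 powr (1 - 3 * lam)) ^ k < 1"
    using order_tendstoD(2)[OF \<eta>_lim, of 1] order_tendstoD(2)[OF lim2, of 1] order_tendstoD(2)[OF lim3, of 1]
    by (simp add: eventually_conj_iff)
  then obtain k0 where k0: "\<And>k. k \<ge> k0 \<Longrightarrow> \<eta> k < 1 \<and> 20 * 2 ^ k * \<eta> k ^ 3 + 7 * \<eta> k ^ 4 < 1 \<and>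
      16 * (2 * c + 1) ^ 3 * (2 powr (1 - 3 * lam)) ^ k < 1"
    unfolding eventually_sequentially by blast
  have K3': "16 * K k ^ 3 \<le> (2 ^ k)\<^sup>2" if "k \<ge> k0" for k
  proof -
    have "16 * (2 * c + 1) ^ 3 * (2 powr (1 - 3 * lam)) ^ k * (2 ^ k)\<^sup>2 \<le> 1 * (2 ^ k)\<^sup>2"
      using k0[OF that] by (intro mult_right_mono) auto
    then show ?thesis using K3[of k] by linarith
  qed
  define W where "W k = {p \<in> near_curve (2 ^ k) (K k) (R + 1). 0 < disc p \<and> of_int (disc p) \<le> (K k)\<^sup>2}" for k
  define G where "G k = (if k \<ge> k0 then W k else {})" for k
  define B where "B = 1200000000 * (2 * (R + 1) + 3) * (2 * c + 1)\<^sup>2"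
  have B: "0 \<le> B" using R by (simp add: B_def)
  have G: "finite (G k) \<and> real (card (G k)) \<le> B * (2 * real k + 5)\<^sup>2 * 2 powr ((2 - 2 * lam) * real k)" for k
  proof (cases "k \<ge> k0")
    case True
    have KQ: "K k \<le> 2 ^ k"
    proof -
      have "K k ^ 3 \<le> (2 ^ k)\<^sup>2" using K3'[OF True] K1[of k] zero_le_power[of "K k" 3] by linarith
      also have "\<dots> \<le> (2 ^ k) ^ 3" by (rule power_increasing) auto
      finally show ?thesis using K1[of k] by (simp add: power_mono_iff)
    qed
    obtain n where n: "(K k)\<^sup>2 \<le> 2 ^ n" "2 ^ n \<le> 2 * (K k)\<^sup>2"
    proof -
      define n where "n = nat \<lceil>log 2 ((K k)\<^sup>2)\<rceil>"
      have "0 \<le> log 2 ((K k)\<^sup>2)" using K1[of k] by (simp add: one_le_power)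
      then have "log 2 ((K k)\<^sup>2) \<le> real n" "real n \<le> log 2 ((K k)\<^sup>2) + 1"
        unfolding n_def by linarith+
      then have "2 powr log 2 ((K k)\<^sup>2) \<le> 2 powr real n" "2 powr real n \<le> 2 powr (log 2 ((K k)\<^sup>2) + 1)"
        by (simp_all only: powr_le_cancel_iff one_less_numeral_iff semiring_norm)
      then show ?thesis using that[of n] K1[of k] by (simp add: powr_add powr_realpow powr_log_cancel)
    qed
    have "(K k)\<^sup>2 \<le> (2 ^ k)\<^sup>2" by (rule power_mono[OF KQ]) (use K1[of k] in simp)
    then have "(2::real) ^ n \<le> 2 * (2 ^ k)\<^sup>2" using n(2) by linarith
    also have "\<dots> = 2 ^ (2 * k + 1)" by (simp add: power_mult mult.commute[of 2 k])
    finally have nk: "n \<le> 2 * k + 1" by (simp only: power_increasing_iff one_less_numeral_iff semiring_norm)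
    have W: "finite (W k) \<and> real (card (W k)) \<le> 1200000000 * (real n + 4)\<^sup>2 * (2 * (R + 1) + 3) * (K k)\<^sup>2"
      unfolding W_def by (rule card_near_curve_le) (use K1 K3'[OF True] n R in auto)
    have "1200000000 * (real n + 4)\<^sup>2 * (2 * (R + 1) + 3) * (K k)\<^sup>2
      \<le> 1200000000 * (2 * real k + 5)\<^sup>2 * (2 * (R + 1) + 3) * ((2 * c + 1) * 2 powr ((1 - lam) * real k))\<^sup>2"
      using nk R K_le[of k] K1[of k] by (intro mult_mono power_mono) auto
    also have "((2 * c + 1) * 2 powr ((1 - lam) * real k))\<^sup>2 = (2 * c + 1)\<^sup>2 * 2 powr ((2 - 2 * lam) * real k)"
      unfolding power_mult_distrib pp by (simp add: algebra_simps)
    also have "1200000000 * (2 * real k + 5)\<^sup>2 * (2 * (R + 1) + 3) * ((2 * c + 1)\<^sup>2 * 2 powr ((2 - 2 * lam) * real k))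
       = B * (2 * real k + 5)\<^sup>2 * 2 powr ((2 - 2 * lam) * real k)" by (simp add: B_def)
    finally show ?thesis using W True by (simp add: G_def)
  qed (use B in \<open>simp add: G_def\<close>)
  define h where "h k = 2 powr (- (1 + lam) * real k)" for k :: nat
  define V where "V k p = {of_int (fst (snd p)) / of_int (fst p) - h k .. of_int (fst (snd p)) / of_int (fst p) + h k}"
    for k and p :: cubic
  show ?thesis
  proof (rule hausdorff_measure_limsup_eq_0[where G = G and V = V and r = "\<lambda>k. 2 * h k", OF s(1)])
    show "finite (G k)" for k using G by blast
    show "bounded (V k i)" for k i by (simp add: V_def)
    show "diameter (V k i) \<le> 2 * h k" for k i by (simp add: V_def h_def)
    show "0 \<le> 2 * h k" for k by (simp add: h_def)
    have "h \<longlonglongrightarrow> 0" unfolding h_def[abs_def] pw by (rule lim) (use lam in simp)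
    then show "(\<lambda>k. 2 * h k) \<longlonglongrightarrow> 0" by (auto intro: tendsto_mult_right_zero)
    define \<theta> where "\<theta> = 2 powr (2 - 2 * lam - (1 + lam) * s)"
    have \<theta>: "0 < \<theta>" "\<theta> < 1" using s(2) by (simp_all add: \<theta>_def powr_less_one)
    have "summable (\<lambda>k. B * 2 powr s * ((2 * real k + 5)\<^sup>2 * \<theta> ^ k))"
      by (intro summable_mult summable_poly_times_geometric \<theta>)
    then show "summable (\<lambda>k. real (card (G k)) * (2 * h k) powr s)"
    proof (rule summable_comparison_test')
      fix k :: nat
      have hp: "(2 * h k) powr s = 2 powr s * 2 powr (- (1 + lam) * s * real k)"
        by (simp add: h_def powr_mult powr_powr mult_ac)
      have "real (card (G k)) * (2 * h k) powr s \<le> B * (2 * real k + 5)\<^sup>2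
          * 2 powr ((2 - 2 * lam) * real k) * (2 powr s * 2 powr (- (1 + lam) * s * real k))"
        unfolding hp using G by (intro mult_right_mono) auto
      also have "B * (2 * real k + 5)\<^sup>2 * 2 powr ((2 - 2 * lam) * real k) * (2 powr s * 2 powr (- (1 + lam) * s * real k))
        = B * 2 powr s * ((2 * real k + 5)\<^sup>2 * (2 powr ((2 - 2 * lam) * real k) * 2 powr (- (1 + lam) * s * real k)))"
        by (simp add: mult_ac)
      also have "2 powr ((2 - 2 * lam) * real k) * 2 powr (- (1 + lam) * s * real k) = \<theta> ^ k"
        unfolding \<theta>_def pw[symmetric] powr_add[symmetric] by (simp add: algebra_simps)
      finally show "norm (real (card (G k)) * (2 * h k) powr s) \<le> B * 2 powr s * ((2 * real k + 5)\<^sup>2 * \<theta> ^ k)"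
        by simp
    qed
    fix x assume "x \<in> S_g {-R..R} lam"
    then have x: "\<bar>x\<bar> \<le> R" "infinite (approximants x lam)" by (auto simp: S_g_eq)
    show "\<exists>\<^sub>\<infinity>k. x \<in> (\<Union>i\<in>G k. V k i)"
      unfolding INFM_nat_le
    proof
      fix m
      define N where "N = (2::int) ^ max m k0"
      have "\<not> approximants x lam \<subseteq> {p \<in> approximants x lam. fst p < N}"
        using x(2) finite_approximants_below[of lam x N] lam by (auto dest: finite_subset)
      then obtain p where p: "p \<in> approximants x lam" "N \<le> fst p" by force
      obtain p0 p1 p2 p3 where pp: "p = (p0, p1, p2, p3)" by (cases p)
      have p0: "N \<le> p0" "1 \<le> p0" using p by (auto simp: pp approximants_def)
      then have "1 \<le> nat p0" by simp
      then obtain k where k: "2 ^ k \<le> nat p0" "nat p0 < 2 ^ (k + 1)"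
        using ex_power_ivl1[of 2 "nat p0"] by blast
      have "real (2 ^ k) \<le> real (nat p0)" "real (nat p0) < real (2 ^ (k + 1))"
        using k by (simp_all only: of_nat_le_iff of_nat_less_iff)
      then have Q: "2 ^ k \<le> real_of_int p0" "real_of_int p0 < 2 * 2 ^ k" using p0 by simp_all
      have "real_of_int N \<le> real_of_int p0" using p0 by simp
      moreover have "real_of_int N = 2 ^ max m k0" by (simp add: N_def)
      ultimately have "(2::real) ^ max m k0 < 2 ^ Suc k" using Q(2) unfolding power_Suc by linarith
      then have mk: "m \<le> k" "k0 \<le> k"
        by (simp_all only: power_strict_increasing_iff one_less_numeral_iff semiring_norm)
      define \<epsilon> where "\<epsilon> = 2 powr (- lam * real k)"
      have "real_of_int p0 powr (- lam) \<le> (2 ^ k) powr (- lam)" using Q lam by (intro powr_mono2') auto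
      also have "\<dots> = \<epsilon>" by (simp add: \<epsilon>_def powr_realpow[symmetric] powr_powr mult.commute)
      finally have "real_of_int p0 powr (- lam) \<le> \<epsilon>" .
      then have e: "\<bar>of_int p0 * x - of_int p1\<bar> \<le> \<epsilon>" "\<bar>of_int p0 * x ^ 2 - of_int p2\<bar> \<le> \<epsilon>"
       "\<bar>of_int p0 * x ^ 3 - of_int p3\<bar> \<le> \<epsilon>" and gen: "generic (p0, p1, p2, p3)"
        using p(1) unfolding pp approximants_def by auto
      have "p \<in> W k"
        unfolding W_def K_def pp
        using generic_in_near_curve[OF gen _ Q x(1) R e, of "\<eta> k"] k0[OF mk(2)]
        by (simp add: \<eta>_def c_def \<epsilon>_def)
      then have "p \<in> G k" using mk by (simp add: G_def)
      moreover have "x \<in> V k p"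
      proof -
        have "x - of_int p1 / of_int p0 = (of_int p0 * x - of_int p1) / of_int p0"
          using p0 by (simp add: field_simps)
        then have "\<bar>x - of_int p1 / of_int p0\<bar> = \<bar>of_int p0 * x - of_int p1\<bar> / of_int p0"
          using p0 by simp
        also have "\<dots> \<le> \<epsilon> / 2 ^ k" using e(1) Q by (intro frac_le) auto
        also have "\<dots> = 2 powr (- lam * real k) * 2 powr (- real k)"
          by (simp add: \<epsilon>_def powr_minus powr_realpow divide_inverse)
        also have "\<dots> = h k" unfolding h_def powr_add[symmetric] by (simp add: algebra_simps)
        finally show ?thesis unfolding V_def pp by (simp; linarith)
      qed
      ultimately show "\<exists>n\<ge>m. x \<in> (\<Union>i\<in>G n. V n i)" using mk by blast
    qed
  qed
qed

text \<open>
  Cover by dyadic intervals: of the order of \<open>2 ^ k\<close> intervals of length \<open>2 powr (- k)\<close> have total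
  weight of the order of \<open>2 powr ((1 - s) * k)\<close>, which is summable.
\<close>
lemma hausdorff_measure_real_interval:
  assumes s: "1 < s"
  shows "hausdorff_measure s {- real n..real n} = 0"
proof (rule hausdorff_measure_limsup_eq_0[where
    G = "\<lambda>k. {- int n * 2 ^ k..int n * 2 ^ k}" and V = "\<lambda>k j. {of_int j / 2 ^ k..(of_int j + 1) / 2 ^ k}"
    and r = "\<lambda>k. (1 / 2) ^ k"])
  show "0 < s" using s by simp
  show "diameter {real_of_int i / 2 ^ k..(real_of_int i + 1) / 2 ^ k} \<le> (1 / 2) ^ k" for i k
    by (simp add: divide_le_cancel power_one_over field_simps)
  show "(\<lambda>k. (1 / 2 :: real) ^ k) \<longlonglongrightarrow> 0" by (rule LIMSEQ_power_zero) simp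
  have "summable (\<lambda>k. (2 * real n + 1) * (2 powr (1 - s)) ^ k)"
    using s by (intro summable_mult summable_geometric) (simp add: powr_less_one)
  then show "summable (\<lambda>k. real (card {- int n * 2 ^ k..int n * 2 ^ k}) * ((1 / 2) ^ k) powr s)"
  proof (rule summable_comparison_test')
    fix k :: nat
    have h: "((1 / 2) ^ k) powr s = 2 powr (- (s * real k))"
    proof -
      have "(1 / 2 :: real) ^ k = 2 powr (- real k)"
        by (simp add: powr_minus powr_realpow power_one_over inverse_eq_divide)
      then show ?thesis by (simp only: powr_powr) (simp add: mult.commute)
    qed
    have "real (card {- int n * 2 ^ k..int n * 2 ^ k}) = 2 * real n * 2 ^ k + 1" by (simp add: nat_add_distrib nat_mult_distrib nat_power_eq)
    also have "\<dots> \<le> (2 * real n + 1) * 2 ^ k" by (simp add: algebra_simps)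
    finally have "real (card {- int n * 2 ^ k..int n * 2 ^ k}) * ((1 / 2) ^ k) powr s
        \<le> (2 * real n + 1) * 2 ^ k * 2 powr (- (s * real k))" unfolding h by (rule mult_right_mono) simp
    also have "(2 * real n + 1) * 2 ^ k * 2 powr (- (s * real k))
        = (2 * real n + 1) * (2 powr real k * 2 powr (- (s * real k)))"
      by (simp add: powr_realpow)
    also have "2 powr real k * 2 powr (- (s * real k)) = (2 powr (1 - s)) ^ k"
      by (simp add: powr_realpow[symmetric] powr_powr powr_add[symmetric] algebra_simps)
    finally show "norm (real (card {- int n * 2 ^ k..int n * 2 ^ k}) * ((1 / 2) ^ k) powr s)
        \<le> (2 * real n + 1) * (2 powr (1 - s)) ^ k" by simp
  qed
  fix x assume x: "x \<in> {- real n..real n}"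
  have "x \<in> (\<Union>i\<in>{- int n * 2 ^ k..int n * 2 ^ k}. {of_int i / 2 ^ k..(of_int i + 1) / 2 ^ k})" for k
  proof
    have "x * 2 ^ k \<le> real n * 2 ^ k" "- real n * 2 ^ k \<le> x * 2 ^ k"
      using x by (intro mult_right_mono; simp)+
    then have "x * 2 ^ k < real n * 2 ^ k + 1" "- (real n * 2 ^ k) \<le> x * 2 ^ k" by linarith+
    then show "\<lfloor>x * 2 ^ k\<rfloor> \<in> {- int n * 2 ^ k..int n * 2 ^ k}"
      unfolding atLeastAtMost_iff le_floor_iff floor_le_iff by (intro conjI) simp_all
    have "of_int \<lfloor>x * 2 ^ k\<rfloor> \<le> x * 2 ^ k" "x * 2 ^ k \<le> of_int \<lfloor>x * 2 ^ k\<rfloor> + 1" by linarith+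
    then show "x \<in> {of_int \<lfloor>x * 2 ^ k\<rfloor> / 2 ^ k..(of_int \<lfloor>x * 2 ^ k\<rfloor> + 1) / 2 ^ k}"
      by (simp add: field_simps)
  qed
  then show "\<exists>\<^sub>\<infinity>k. x \<in> (\<Union>i\<in>{- int n * 2 ^ k..int n * 2 ^ k}. {of_int i / 2 ^ k..(of_int i + 1) / 2 ^ k})"
    by (simp add: INFM_nat_le)
qed simp_all

lemma S_g_antimono:
  assumes "lam' \<le> lam" shows "S_g I lam \<subseteq> S_g I lam'"
proof -
  have "approximants x lam \<subseteq> approximants x lam'" for x
  proof
    fix p assume p: "p \<in> approximants x lam"
    obtain p0 p1 p2 p3 where pp: "p = (p0, p1, p2, p3)" by (cases p)
    have "1 \<le> p0" using p by (auto simp: pp approximants_def)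
    then have "real_of_int p0 powr (- lam) \<le> real_of_int p0 powr (- lam')" using assms by (intro powr_mono) auto
    then show "p \<in> approximants x lam'" using p unfolding pp approximants_def by (auto intro: less_le_trans)
  qed
  then have "infinite (approximants x lam')" if "infinite (approximants x lam)" for x
    using that infinite_super by blast
  then show ?thesis unfolding S_g_eq by blast
qed

lemma hausdorff_measure_S_g:
  assumes "1 / 3 < lam" "lam \<le> 1" "0 < s" "2 - 2 * lam < (1 + lam) * s"
  shows "hausdorff_measure s (S_g I lam) = 0"
proof -
  have "S_g I lam \<subseteq> (\<Union>n. S_g {- (real n + 1)..real n + 1} lam)"
  proof
    fix x assume x: "x \<in> S_g I lam"
    obtain n where "\<bar>x\<bar> \<le> real n" using real_arch_simple by blast
    then have "x \<in> S_g {- (real n + 1)..real n + 1} lam" using x by (auto simp: S_g_eq)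
    then show "x \<in> (\<Union>n. S_g {- (real n + 1)..real n + 1} lam)" by blast
  qed
  then have "hausdorff_measure s (S_g I lam) \<le> hausdorff_measure s (\<Union>n. S_g {- (real n + 1)..real n + 1} lam)"
    by (rule hausdorff_measure_mono)
  also have "hausdorff_measure s (\<Union>n. S_g {- (real n + 1)..real n + 1} lam) = 0"
    by (intro hausdorff_measure_UN_eq_0 hausdorff_measure_S_g_bounded assms) simp
  finally show ?thesis by simp
qed

lemma hausdorff_measure_real_set:
  assumes "1 < s" shows "hausdorff_measure s (A :: real set) = 0"
proof -
  have "A \<subseteq> (\<Union>n. {- real n..real n})"
  proof
    fix x assume "x \<in> A"
    obtain n where "\<bar>x\<bar> \<le> real n" using real_arch_simple by blast
    then have "x \<in> {- real n..real n}" by auto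
    then show "x \<in> (\<Union>n. {- real n..real n})" by blast
  qed
  then have "hausdorff_measure s A \<le> hausdorff_measure s (\<Union>n. {- real n..real n})"
    by (rule hausdorff_measure_mono)
  also have "hausdorff_measure s (\<Union>n. {- real n..real n}) = 0"
    by (intro hausdorff_measure_UN_eq_0 hausdorff_measure_real_interval assms)
  finally show ?thesis by simp
qed

text \<open>
  For \<open>lam = 1 / 3\<close> the bound is \<open>1\<close>, the dimension of the line. For \<open>lam > 1\<close> the set is contained
  in the one for the exponent \<open>1\<close>, for which the bound is \<open>0\<close>.
\<close>
theorem corollary1:
  fixes I :: "real set" and lam :: real
  assumes "is_interval I" and "1 / 3 \<le> lam"
  shows "hausdorff_dim (S_g I lam) \<le> ereal (max ((2 - 2 * lam) / (1 + lam)) 0)"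
proof (rule hausdorff_dim_le)
  fix s assume s: "max ((2 - 2 * lam) / (1 + lam)) 0 < s"
  show "hausdorff_measure s (S_g I lam) = 0"
  proof (cases "lam = 1 / 3")
    case True
    then show ?thesis using s by (intro hausdorff_measure_real_set) (simp add: True)
  next
    case False
    then have lam: "1 / 3 < lam" using assms(2) by simp
    have s0: "0 < s" "2 - 2 * lam < (1 + lam) * s" using s lam by (simp_all add: field_simps)
    show ?thesis
    proof (cases "lam \<le> 1")
      case True
      then show ?thesis using lam s0 by (intro hausdorff_measure_S_g)
    next
      case False
      then have "hausdorff_measure s (S_g I lam) \<le> hausdorff_measure s (S_g I 1)"
        by (intro hausdorff_measure_mono S_g_antimono) simp
      also have "hausdorff_measure s (S_g I 1) = 0" using s0 by (intro hausdorff_measure_S_g) auto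
      finally show ?thesis by simp
    qed
  qed
qed simp

end
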